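(* Let $\mathcal A$ be a right asphericity structure and let $u:A\to B$ be a functor between small categories. The following conditions are equivalent: (a) $u$ is smooth; (b) for every diagram of cartesian (pullback) squares in $\mathsf{Cat}$ $$\begin{array}{ccc} A'' & \to & B''\\ \downarrow & & \downarrow\\ A' & \to & B'\\ \downarrow & & \downarrow\\ A & \xrightarrow{u} & B,\end{array}$$ the base change morphism associated with the upper square is componentwise an aspheric functor, i.e. denoting by $\mathcal D$ the upper square, for every functor $F:B''\to\mathsf{Cat}$ and every object $a'$ of $A'$, the functor $\kappa_{\mathcal D,F}(a')$ is aspheric.
   Context: $\mathsf{Cat}$ is the category of small categories and functors. For a functor $u:A\to B$ and an object $b$ of $B$, $A/b$ denotes the category whose objects are pairs $(a,p:u(a)\to b)$, a morphism $(a,p)\to(a',p')$ being an arrow $f:a\to a'$ of $A$ with $p'\,u(f)=p$. A right asphericity structure is a class $\mathcal A$ of small categories such that: (As1) every small category with a final object is in $\mathcal A$; (As2) for every functor $u:A\to B$ between small categories, if $B$ is in $\mathcal A$ and $A/b$ is in $\mathcal A$ for every object $b$ of $B$, then $A$ is in $\mathcal A$. A functor $u:A\to B$ between small categories is aspheric if $A/b$ is in $\mathcal A$ for every object $b$ of $B$. It is smooth (with respect to $\mathcal A$) if for every diagram of cartesian squares in $\mathsf{Cat}$, $A''\xrightarrow{v}A'\to A$ over $B''\xrightarrow{w}B'\to B$ with right-most vertical arrow $u$ (i.e. $A'=B'\times_BA$, $A''=B''\times_{B'}A'$), if $w$ is aspheric then so is $v$. For $F:I\to\mathsf{Cat}$,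 the category $\int F$ (Grothendieck construction) has objects the pairs $(i,x)$ with $i\in\mathrm{Ob}(I)$, $x\in\mathrm{Ob}(F(i))$, and morphisms $(i,x)\to(i',x')$ the pairs $(k,f)$ with $k:i\to i'$ in $I$ and $f:F(k)(x)\to x'$ in $F(i')$, composition being $(k',f')\circ(k,f)=(k'k,\,f'\cdot F(k')(f))$; the canonical functor $\int F\to I$ is $(i,x)\mapsto i$. For a functor $q:I\to K$ between small categories, $q_!:\underline{\mathsf{Hom}}(I,\mathsf{Cat})\to\underline{\mathsf{Hom}}(K,\mathsf{Cat})$ is the functor between functor categories given by $q_!(F)(k)=(\int F)/k$, formed with respect to $\int F\to I\xrightarrow{q}K$; and $q^*(G)=G\circ q$. Base change morphism: let $\mathcal D$ be a cartesian square in $\mathsf{Cat}$ with top arrow $t:X'\to X$, left arrow $q':X'\to Y'$, right arrow $q:X\to Y$, bottom arrow $s:Y'\to Y$ ($qt=sq'$). The base change morphism $\kappa_{\mathcal D}:q'_!t^*\to s^*q_!$ is the natural transformation whose component at $F:X\to\mathsf{Cat}$ and $y'\in\mathrm{Ob}(Y')$ is the functor $$\kappa_{\mathcal D,F}(y'):(\textstyle\int F t)/y'\to(\int F)/s(y')$$ induced by the functor $\int Ft\to\int F$, $(x',\xi)\mapsto(t(x'),\xi)$; explicitly, $((x',\xi),\,p:q'(x')\to y')\mapsto((t(x'),\xi),\,s(p):q(t(x'))=s(q'(x'))\to s(y'))$. In (b), the square has $X'=A''$, $X=B''$, $Y'=A'$, $Y=B'$. *)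

theory Defs
  imports Main
begin

text \<open>
  Objects and arrows of all categories are elements of one type, freely generated from atoms
  by pairs \<open>(x, y)\<close> and by labelled arrows \<open>f : x \<rightarrow> y\<close>, so that comma categories, fibre products
  and Grothendieck constructions of categories over this type are again categories over this
  type. A labelled arrow records its source and target, which the bare label \<open>f\<close> need not
  determine.
\<close>

datatype 'a elt =
    Atom 'a
  | Pr (pfst: "'a elt") (psnd: "'a elt")
  | Lab (lsrc: "'a elt") (lab: "'a elt") (ltgt: "'a elt")

text \<open>
  The ambient notion of smallness. The small sets of any Grothendieck universe have these closure
  properties; infinity and power sets are not needed and not demanded. Because the closure
  properties are invariant under bijections, it does not matter how pairs are encoded.
\<close>

locale universe =
  fixes small :: "'a elt set \<Rightarrow> bool"
  assumes small_doubleton: "small {x, y}"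
    and small_subset: "small S \<Longrightarrow> T \<subseteq> S \<Longrightarrow> small T"
    and small_image: "small S \<Longrightarrow> small (f ` S)"
    and small_UN: "small I \<Longrightarrow> (\<And>i. i \<in> I \<Longrightarrow> small (X i)) \<Longrightarrow> small (\<Union>i\<in>I. X i)"

subsection \<open>Categories and functors\<close>

record 'a cat =
  Ob :: "'a elt set"
  Mor :: "'a elt set"
  Dom :: "'a elt \<Rightarrow> 'a elt"
  Cod :: "'a elt \<Rightarrow> 'a elt"
  Id :: "'a elt \<Rightarrow> 'a elt"
  Comp :: "'a elt \<Rightarrow> 'a elt \<Rightarrow> 'a elt"

text \<open>\<open>Comp C g f\<close> is \<open>g \<circ> f\<close>; it is only meaningful when \<open>Cod C f = Dom C g\<close>.\<close>

locale category =
  fixes C :: "'a cat"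
  assumes Dom_Ob: "f \<in> Mor C \<Longrightarrow> Dom C f \<in> Ob C"
    and Cod_Ob: "f \<in> Mor C \<Longrightarrow> Cod C f \<in> Ob C"
    and Id_Mor: "x \<in> Ob C \<Longrightarrow> Id C x \<in> Mor C"
    and Dom_Id: "x \<in> Ob C \<Longrightarrow> Dom C (Id C x) = x"
    and Cod_Id: "x \<in> Ob C \<Longrightarrow> Cod C (Id C x) = x"
    and Comp_Mor: "\<lbrakk>f \<in> Mor C; g \<in> Mor C; Cod C f = Dom C g\<rbrakk> \<Longrightarrow> Comp C g f \<in> Mor C"
    and Dom_Comp: "\<lbrakk>f \<in> Mor C; g \<in> Mor C; Cod C f = Dom C g\<rbrakk> \<Longrightarrow> Dom C (Comp C g f) = Dom C f"
    and Cod_Comp: "\<lbrakk>f \<in> Mor C; g \<in> Mor C; Cod C f = Dom C g\<rbrakk> \<Longrightarrow> Cod C (Comp C g f) = Cod C g"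
    and Comp_Id_right: "f \<in> Mor C \<Longrightarrow> Comp C f (Id C (Dom C f)) = f"
    and Comp_Id_left: "f \<in> Mor C \<Longrightarrow> Comp C (Id C (Cod C f)) f = f"
    and Comp_assoc: "\<lbrakk>f \<in> Mor C; g \<in> Mor C; h \<in> Mor C; Cod C f = Dom C g; Cod C g = Dom C h\<rbrakk>
      \<Longrightarrow> Comp C h (Comp C g f) = Comp C (Comp C h g) f"

definition small_category :: "('a elt set \<Rightarrow> bool) \<Rightarrow> 'a cat \<Rightarrow> bool" where
  "small_category small C \<longleftrightarrow> category C \<and> small (Ob C) \<and> small (Mor C)"

record 'a ftr =
  OM :: "'a elt \<Rightarrow> 'a elt"
  AM :: "'a elt \<Rightarrow> 'a elt"

locale is_functor =
  fixes A B :: "'a cat" and u :: "'a ftr"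
  assumes OM_Ob: "x \<in> Ob A \<Longrightarrow> OM u x \<in> Ob B"
    and AM_Mor: "f \<in> Mor A \<Longrightarrow> AM u f \<in> Mor B"
    and Dom_AM: "f \<in> Mor A \<Longrightarrow> Dom B (AM u f) = OM u (Dom A f)"
    and Cod_AM: "f \<in> Mor A \<Longrightarrow> Cod B (AM u f) = OM u (Cod A f)"
    and AM_Id: "x \<in> Ob A \<Longrightarrow> AM u (Id A x) = Id B (OM u x)"
    and AM_Comp: "\<lbrakk>f \<in> Mor A; g \<in> Mor A; Cod A f = Dom A g\<rbrakk>
      \<Longrightarrow> AM u (Comp A g f) = Comp B (AM u g) (AM u f)"

text \<open>
  The maps of a functor are total functions whose values outside its source category are
  irrelevant; \<open>ftr_eq A u v\<close> is equality of \<open>u\<close> and \<open>v\<close> as functors with source \<open>A\<close>.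
\<close>

definition ftr_eq :: "'a cat \<Rightarrow> 'a ftr \<Rightarrow> 'a ftr \<Rightarrow> bool" where
  "ftr_eq A u v \<longleftrightarrow> (\<forall>x\<in>Ob A. OM u x = OM v x) \<and> (\<forall>f\<in>Mor A. AM u f = AM v f)"

definition ftr_id :: "'a ftr" where
  "ftr_id = \<lparr>OM = (\<lambda>x. x), AM = (\<lambda>f. f)\<rparr>"

definition ftr_comp :: "'a ftr \<Rightarrow> 'a ftr \<Rightarrow> 'a ftr"  (infixl "\<circ>\<^sub>F" 55) where
  "v \<circ>\<^sub>F u = \<lparr>OM = OM v \<circ> OM u, AM = AM v \<circ> AM u\<rparr>"

text \<open>
  Cartesian squares in the category of small categories, with top arrow \<open>t : X' \<rightarrow> X\<close>, left arrow
  \<open>q' : X' \<rightarrow> Y'\<close>, right arrow \<open>q : X \<rightarrow> Y\<close> and bottom arrow \<open>s : Y' \<rightarrow> Y\<close>.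
\<close>

definition cartesian_square ::
  "('a elt set \<Rightarrow> bool) \<Rightarrow> 'a cat \<Rightarrow> 'a cat \<Rightarrow> 'a cat \<Rightarrow> 'a cat
    \<Rightarrow> 'a ftr \<Rightarrow> 'a ftr \<Rightarrow> 'a ftr \<Rightarrow> 'a ftr \<Rightarrow> bool" where
  "cartesian_square small X' X Y' Y t q' q s \<longleftrightarrow>
    small_category small X' \<and> small_category small X \<and>
    small_category small Y' \<and> small_category small Y \<and>
    is_functor X' X t \<and> is_functor X' Y' q' \<and> is_functor X Y q \<and> is_functor Y' Y s \<and>
    ftr_eq X' (q \<circ>\<^sub>F t) (s \<circ>\<^sub>F q') \<and>
    (\<forall>Z f g. small_category small Z \<and> is_functor Z X f \<and> is_functor Z Y' g \<and>
        ftr_eq Z (q \<circ>\<^sub>F f) (s \<circ>\<^sub>F g) \<longrightarrow>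
      (\<exists>h. is_functor Z X' h \<and> ftr_eq Z (t \<circ>\<^sub>F h) f \<and> ftr_eq Z (q' \<circ>\<^sub>F h) g \<and>
        (\<forall>h'. is_functor Z X' h' \<and> ftr_eq Z (t \<circ>\<^sub>F h') f \<and> ftr_eq Z (q' \<circ>\<^sub>F h') g \<longrightarrow>
          ftr_eq Z h' h)))"

subsection \<open>Comma categories, asphericity and smoothness\<close>

text \<open>\<open>slice A B u b\<close> is the category \<open>A/b\<close> formed with respect to \<open>u : A \<rightarrow> B\<close>.\<close>

definition slice :: "'a cat \<Rightarrow> 'a cat \<Rightarrow> 'a ftr \<Rightarrow> 'a elt \<Rightarrow> 'a cat" where
  "slice A B u b = \<lparr>
    Ob = {Pr a p | a p. a \<in> Ob A \<and> p \<in> Mor B \<and> Dom B p = OM u a \<and> Cod B p = b},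
    Mor = {Lab (Pr a p) f (Pr a' p') | a p f a' p'.
      a \<in> Ob A \<and> p \<in> Mor B \<and> Dom B p = OM u a \<and> Cod B p = b \<and>
      a' \<in> Ob A \<and> p' \<in> Mor B \<and> Dom B p' = OM u a' \<and> Cod B p' = b \<and>
      f \<in> Mor A \<and> Dom A f = a \<and> Cod A f = a' \<and> Comp B p' (AM u f) = p},
    Dom = lsrc,
    Cod = ltgt,
    Id = (\<lambda>x. Lab x (Id A (pfst x)) x),
    Comp = (\<lambda>g f. Lab (lsrc f) (Comp A (lab g) (lab f)) (ltgt g))\<rparr>"

definition final_object :: "'a cat \<Rightarrow> 'a elt \<Rightarrow> bool" where
  "final_object C e \<longleftrightarrow>
    e \<in> Ob C \<and> (\<forall>x\<in>Ob C. \<exists>!f. f \<in> Mor C \<and> Dom C f = x \<and> Cod C f = e)"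

definition right_asphericity_structure ::
  "('a elt set \<Rightarrow> bool) \<Rightarrow> 'a cat set \<Rightarrow> bool" where
  "right_asphericity_structure small \<A> \<longleftrightarrow>
    (\<forall>C\<in>\<A>. small_category small C) \<and>
    (\<forall>C. small_category small C \<and> (\<exists>e. final_object C e) \<longrightarrow> C \<in> \<A>) \<and>
    (\<forall>A B u. small_category small A \<and> small_category small B \<and> is_functor A B u \<and>
      B \<in> \<A> \<and> (\<forall>b\<in>Ob B. slice A B u b \<in> \<A>) \<longrightarrow> A \<in> \<A>)"

definition aspheric :: "'a cat set \<Rightarrow> 'a cat \<Rightarrow> 'a cat \<Rightarrow> 'a ftr \<Rightarrow> bool" where
  "aspheric \<A> A B u \<longleftrightarrow> (\<forall>b\<in>Ob B. slice A B u b \<in> \<A>)"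

definition smooth ::
  "('a elt set \<Rightarrow> bool) \<Rightarrow> 'a cat set \<Rightarrow> 'a cat \<Rightarrow> 'a cat \<Rightarrow> 'a ftr \<Rightarrow> bool" where
  "smooth small \<A> A B u \<longleftrightarrow>
    (\<forall>A' B' A'' B'' a b v w u' u''.
      cartesian_square small A' A B' B a u' u b \<and>
      cartesian_square small A'' A' B'' B' v u'' u' w \<and>
      aspheric \<A> B'' B' w \<longrightarrow> aspheric \<A> A'' A' v)"

subsection \<open>Functors to small categories, Grothendieck construction\<close>

record 'a cftr =
  CO :: "'a elt \<Rightarrow> 'a cat"
  CM :: "'a elt \<Rightarrow> 'a ftr"

definition cat_valued_functor :: "('a elt set \<Rightarrow> bool) \<Rightarrow> 'a cat \<Rightarrow> 'a cftr \<Rightarrow> bool" where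
  "cat_valued_functor small I F \<longleftrightarrow>
    (\<forall>i\<in>Ob I. small_category small (CO F i)) \<and>
    (\<forall>k\<in>Mor I. is_functor (CO F (Dom I k)) (CO F (Cod I k)) (CM F k)) \<and>
    (\<forall>i\<in>Ob I. ftr_eq (CO F i) (CM F (Id I i)) ftr_id) \<and>
    (\<forall>k\<in>Mor I. \<forall>l\<in>Mor I. Cod I k = Dom I l \<longrightarrow>
      ftr_eq (CO F (Dom I k)) (CM F (Comp I l k)) (CM F l \<circ>\<^sub>F CM F k))"

definition groth :: "'a cat \<Rightarrow> 'a cftr \<Rightarrow> 'a cat" where
  "groth I F = \<lparr>
    Ob = {Pr i x | i x. i \<in> Ob I \<and> x \<in> Ob (CO F i)},
    Mor = {Lab (Pr i x) (Pr k f) (Pr i' x') | i x k f i' x'.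
      i \<in> Ob I \<and> x \<in> Ob (CO F i) \<and> i' \<in> Ob I \<and> x' \<in> Ob (CO F i') \<and>
      k \<in> Mor I \<and> Dom I k = i \<and> Cod I k = i' \<and>
      f \<in> Mor (CO F i') \<and> Dom (CO F i') f = OM (CM F k) x \<and> Cod (CO F i') f = x'},
    Dom = lsrc,
    Cod = ltgt,
    Id = (\<lambda>z. Lab z (Pr (Id I (pfst z)) (Id (CO F (pfst z)) (psnd z))) z),
    Comp = (\<lambda>m' m. Lab (lsrc m)
      (Pr (Comp I (pfst (lab m')) (pfst (lab m)))
          (Comp (CO F (pfst (ltgt m'))) (psnd (lab m'))
            (AM (CM F (pfst (lab m'))) (psnd (lab m)))))
      (ltgt m'))\<rparr>"

definition groth_proj :: "'a ftr" where
  "groth_proj = \<lparr>OM = pfst, AM = (\<lambda>m. pfst (lab m))\<rparr>"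

text \<open>
  The values of \<open>q\<^sub>!\<close> and \<open>q\<^sup>*\<close> on a functor \<open>F\<close>, for \<open>q : I \<rightarrow> K\<close>. An arrow \<open>l : k \<rightarrow> k'\<close> of \<open>K\<close>
  acts on \<open>(\<integral>F)/k\<close> by \<open>(z, p) \<mapsto> (z, l p)\<close>.
\<close>

definition shriek :: "'a cat \<Rightarrow> 'a cat \<Rightarrow> 'a ftr \<Rightarrow> 'a cftr \<Rightarrow> 'a cftr" where
  "shriek I K q F = \<lparr>
    CO = slice (groth I F) K (q \<circ>\<^sub>F groth_proj),
    CM = (\<lambda>l. let post = (\<lambda>y. Pr (pfst y) (Comp K l (psnd y))) in
      \<lparr>OM = post, AM = (\<lambda>m. Lab (post (lsrc m)) (lab m) (post (ltgt m)))\<rparr>)\<rparr>"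

definition pull :: "'a ftr \<Rightarrow> 'a cftr \<Rightarrow> 'a cftr" where
  "pull q G = \<lparr>CO = CO G \<circ> OM q, CM = CM G \<circ> AM q\<rparr>"

text \<open>The functor from \<open>\<integral>F t\<close> to \<open>\<integral>F\<close> given by \<open>(x', \<xi>) \<mapsto> (t(x'), \<xi>)\<close>.\<close>

definition groth_map :: "'a ftr \<Rightarrow> 'a ftr" where
  "groth_map t =
    (let om = (\<lambda>z. Pr (OM t (pfst z)) (psnd z)) in
     \<lparr>OM = om,
      AM = (\<lambda>m. Lab (om (lsrc m)) (Pr (AM t (pfst (lab m))) (psnd (lab m))) (om (ltgt m)))\<rparr>)"

text \<open>
  The component \<open>\<kappa>\<^bsub>D,F\<^esub>(y') : (\<integral>F t)/y' \<rightarrow> (\<integral>F)/s(y')\<close> of the base change morphism. Its underlying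
  maps are given by the same formula for every \<open>F\<close> and \<open>y'\<close>, and only depend on \<open>t\<close> and \<open>s\<close>.
\<close>

definition base_change :: "'a ftr \<Rightarrow> 'a ftr \<Rightarrow> 'a ftr" where
  "base_change t s =
    (let om = (\<lambda>y. Pr (OM (groth_map t) (pfst y)) (AM s (psnd y))) in
     \<lparr>OM = om,
      AM = (\<lambda>m. Lab (om (lsrc m)) (AM (groth_map t) (lab m)) (om (ltgt m)))\<rparr>)"

end

theory Submission
  imports Defs
begin

text \<open>
  The functor \<open>F\<close> disappears from condition (b): \<open>\<integral>F t \<rightarrow> \<integral>F\<close> is the pullback of \<open>A'' \<rightarrow> B''\<close>, so
  by pasting, the base change functor at \<open>a'\<close> is the functor \<open>X'/a' \<rightarrow> X/u'(a')\<close> attached to a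
  single cartesian square over \<open>u'\<close> with \<open>X = \<integral>F\<close>. Given an object \<open>(x, p)\<close> of \<open>X/u'(a')\<close>, the cone
  \<open>J\<close> obtained from \<open>X/x\<close> by adjoining a final object maps to \<open>B'\<close>, the new arrows going to \<open>p\<close>
  precomposed with the structure arrows. The inclusion \<open>X/x \<rightarrow> J\<close> is aspheric because \<open>X/x\<close> has a
  final object, and by smoothness so is its pullback along \<open>J \<times>\<^bsub>B'\<^esub> A' \<rightarrow> J\<close>. The slice of that
  pullback over the object (apex, \<open>a'\<close>) is isomorphic to the slice of the base change
  functor over \<open>(x, p)\<close>.
  Conversely, take for \<open>F\<close> the constant functor with value a point.
\<close>


subsection \<open>Small sets and small categories\<close>

context universe
begin

text \<open>Only doubletons are given, so \<open>insert x S\<close> is covered by the sets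
  \<open>{x, z}\<close> for \<open>z\<close> in \<open>S\<close>. That union is empty for empty
  \<open>S\<close>, hence the case split.\<close>

lemma small_insert:
  assumes "small S"
  shows "small (insert x S)"
proof (cases "S = {}")
  case True
  then show ?thesis using small_doubleton[of x x] by simp
next
  case False
  then obtain y where y: "y \<in> S" by blast
  have "small (\<Union>z\<in>S. {x, z})" by (rule small_UN) (auto simp: assms small_doubleton)
  then show ?thesis by (rule small_subset) (use y in auto)
qed

lemma small_Un:
  assumes "small S" "small T"
  shows "small (S \<union> T)"
proof -
  \<comment> \<open>A binary union is a union over a doubleton of indices; the two indices differ
    because constructors are free.\<close>
  have "small (\<Union>i\<in>{Atom undefined :: 'a elt, Pr (Atom undefined) (Atom undefined)}.
      if i = Atom undefined then S else T)"
    by (rule small_UN) (auto simp: assms small_doubleton)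
  then show ?thesis by (rule small_subset) auto
qed

lemma small_Pr:
  assumes "small S" "small T"
  shows "small {Pr x y | x y. x \<in> S \<and> y \<in> T}"
proof -
  have "small (\<Union>x\<in>S. Pr x ` T)" by (intro small_UN small_image assms)
  then show ?thesis by (rule small_subset) auto
qed

lemma small_Lab:
  assumes "small S" "small T" "small U"
  shows "small {Lab x y z | x y z. x \<in> S \<and> y \<in> T \<and> z \<in> U}"
proof -
  have "small (\<Union>x\<in>S. \<Union>y\<in>T. Lab x y ` U)" by (intro small_UN small_image assms)
  then show ?thesis by (rule small_subset) auto
qed

end

lemmas cat_facts = category.Dom_Ob category.Cod_Ob category.Id_Mor category.Dom_Id category.Cod_Id
  category.Comp_Mor category.Dom_Comp category.Cod_Comp category.Comp_Id_right
  category.Comp_Id_left category.Comp_assoc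

lemmas ftr_facts = is_functor.OM_Ob is_functor.AM_Mor is_functor.Dom_AM is_functor.Cod_AM
  is_functor.AM_Id is_functor.AM_Comp

lemma ftr_comp_sel [simp]:
  "OM (v \<circ>\<^sub>F u) x = OM v (OM u x)" "AM (v \<circ>\<^sub>F u) f = AM v (AM u f)"
  by (auto simp: ftr_comp_def)

lemma ftr_id_sel [simp]: "OM ftr_id x = x" "AM ftr_id f = f"
  by (auto simp: ftr_id_def)

lemma is_functor_comp:
  assumes "is_functor A B u" "is_functor B C v"
  shows "is_functor A C (v \<circ>\<^sub>F u)"
  by unfold_locales (simp_all add: ftr_facts[OF assms(1)] ftr_facts[OF assms(2)])

lemma is_functor_id: "is_functor A A ftr_id"
  by unfold_locales simp_all

lemma small_categoryD:
  assumes "small_category small C"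
  shows "category C" "small (Ob C)" "small (Mor C)"
  using assms by (simp_all add: small_category_def)

subsection \<open>Cartesian squares, elementwise\<close>

text \<open>For a commutative square this says that \<open>X'\<close> is, on objects and on arrows,
  in bijection with the strict fibre product. Unique solutions over compatible pairs replace the
  quantification over test categories.\<close>

definition elementwise_cartesian ::
  "'a cat \<Rightarrow> 'a cat \<Rightarrow> 'a cat \<Rightarrow> 'a ftr \<Rightarrow> 'a ftr \<Rightarrow> 'a ftr \<Rightarrow> 'a ftr \<Rightarrow> bool" where
  "elementwise_cartesian X' X Y' t q' q s \<longleftrightarrow>
    (\<forall>x\<in>Ob X. \<forall>y\<in>Ob Y'. OM q x = OM s y \<longrightarrow>
      (\<exists>!z. z \<in> Ob X' \<and> OM t z = x \<and> OM q' z = y)) \<and>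
    (\<forall>f\<in>Mor X. \<forall>g\<in>Mor Y'. AM q f = AM s g \<longrightarrow>
      (\<exists>!h. h \<in> Mor X' \<and> AM t h = f \<and> AM q' h = g))"

definition fibre_product :: "'a cat \<Rightarrow> 'a cat \<Rightarrow> 'a ftr \<Rightarrow> 'a ftr \<Rightarrow> 'a cat" where
  "fibre_product X Y q s = \<lparr>
    Ob = {Pr x y | x y. x \<in> Ob X \<and> y \<in> Ob Y \<and> OM q x = OM s y},
    Mor = {Pr f g | f g. f \<in> Mor X \<and> g \<in> Mor Y \<and> AM q f = AM s g},
    Dom = (\<lambda>m. Pr (Dom X (pfst m)) (Dom Y (psnd m))),
    Cod = (\<lambda>m. Pr (Cod X (pfst m)) (Cod Y (psnd m))),
    Id = (\<lambda>z. Pr (Id X (pfst z)) (Id Y (psnd z))),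
    Comp = (\<lambda>m' m. Pr (Comp X (pfst m') (pfst m)) (Comp Y (psnd m') (psnd m)))\<rparr>"

definition ftr_fst :: "'a ftr" where
  "ftr_fst = \<lparr>OM = pfst, AM = pfst\<rparr>"

definition ftr_snd :: "'a ftr" where
  "ftr_snd = \<lparr>OM = psnd, AM = psnd\<rparr>"

lemma category_fibre_product:
  assumes X: "category X" and Y: "category Y" and q: "is_functor X Z q" and s: "is_functor Y Z s"
  shows "category (fibre_product X Y q s)"
proof -
  note [simp] = cat_facts[OF X] cat_facts[OF Y]
  \<comment> \<open>Compatible arrows have compatible sources and targets, so \<open>Dom\<close> and
    \<open>Cod\<close> stay inside the fibre product.\<close>
  have d: "OM q (Dom X f) = OM s (Dom Y g)" "OM q (Cod X f) = OM s (Cod Y g)"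
    if "f \<in> Mor X" "g \<in> Mor Y" "AM q f = AM s g" for f g
    using that ftr_facts(3,4)[OF q, of f] ftr_facts(3,4)[OF s, of g] by simp_all
  show ?thesis
    by unfold_locales
      (auto simp: fibre_product_def d ftr_facts(5,6)[OF q] ftr_facts(5,6)[OF s])
qed

lemma (in universe) small_category_fibre_product:
  assumes X: "small_category small X" and Y: "small_category small Y"
    and "is_functor X Z q" "is_functor Y Z s"
  shows "small_category small (fibre_product X Y q s)"
  unfolding small_category_def
proof (intro conjI)
  show "category (fibre_product X Y q s)"
    using assms by (auto intro: category_fibre_product dest: small_categoryD)
  show "small (Ob (fibre_product X Y q s))"
    by (rule small_subset[OF small_Pr[OF small_categoryD(2)[OF X] small_categoryD(2)[OF Y]]])
      (auto simp: fibre_product_def)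
  show "small (Mor (fibre_product X Y q s))"
    by (rule small_subset[OF small_Pr[OF small_categoryD(3)[OF X] small_categoryD(3)[OF Y]]])
      (auto simp: fibre_product_def)
qed

lemma is_functor_fst: "is_functor (fibre_product X Y q s) X ftr_fst"
  by unfold_locales (auto simp: fibre_product_def ftr_fst_def)

lemma is_functor_snd: "is_functor (fibre_product X Y q s) Y ftr_snd"
  by unfold_locales (auto simp: fibre_product_def ftr_snd_def)

lemma elementwise_cartesian_fibre_product:
  "elementwise_cartesian (fibre_product X Y q s) X Y ftr_fst ftr_snd q s"
  unfolding elementwise_cartesian_def
proof (intro conjI ballI impI)
  fix x y assume "x \<in> Ob X" "y \<in> Ob Y" "OM q x = OM s y"
  then show "\<exists>!z. z \<in> Ob (fibre_product X Y q s) \<and> OM ftr_fst z = x \<and> OM ftr_snd z = y"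
    by (intro ex1I[of _ "Pr x y"]) (auto simp: fibre_product_def ftr_fst_def ftr_snd_def)
next
  fix f g assume "f \<in> Mor X" "g \<in> Mor Y" "AM q f = AM s g"
  then show "\<exists>!z. z \<in> Mor (fibre_product X Y q s) \<and> AM ftr_fst z = f \<and> AM ftr_snd z = g"
    by (intro ex1I[of _ "Pr f g"]) (auto simp: fibre_product_def ftr_fst_def ftr_snd_def)
qed

text \<open>A functor into \<open>X'\<close> induced by compatible \<open>f\<close> and \<open>g\<close> is defined by unique choice; being
  functorial is a matter of comparing the images of both sides in \<open>X\<close> and \<open>Y'\<close>.\<close>

lemma elementwise_cartesian_lift:
  assumes X': "category X'" and Z: "category Z"
    and t: "is_functor X' X t" and q': "is_functor X' Y' q'"
    and f: "is_functor Z X f" and g: "is_functor Z Y' g"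
    and eq: "ftr_eq Z (q \<circ>\<^sub>F f) (s \<circ>\<^sub>F g)"
    and cart: "elementwise_cartesian X' X Y' t q' q s"
  obtains h where "is_functor Z X' h" "ftr_eq Z (t \<circ>\<^sub>F h) f" "ftr_eq Z (q' \<circ>\<^sub>F h) g"
    "\<And>h'. \<lbrakk>is_functor Z X' h'; ftr_eq Z (t \<circ>\<^sub>F h') f; ftr_eq Z (q' \<circ>\<^sub>F h') g\<rbrakk> \<Longrightarrow> ftr_eq Z h' h"
proof -
  define h where "h = \<lparr>OM = (\<lambda>z. THE x. x \<in> Ob X' \<and> OM t x = OM f z \<and> OM q' x = OM g z),
    AM = (\<lambda>m. THE k. k \<in> Mor X' \<and> AM t k = AM f m \<and> AM q' k = AM g m)\<rparr>"
  note [simp] = cat_facts[OF X'] cat_facts[OF Z] ftr_facts[OF t] ftr_facts[OF q']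
    ftr_facts[OF f] ftr_facts[OF g]
  have ex1: "\<exists>!x. x \<in> Ob X' \<and> OM t x = OM f z \<and> OM q' x = OM g z" if "z \<in> Ob Z" for z
    using cart that eq by (simp add: elementwise_cartesian_def ftr_eq_def)
  have ex1': "\<exists>!k. k \<in> Mor X' \<and> AM t k = AM f m \<and> AM q' k = AM g m" if "m \<in> Mor Z" for m
    using cart that eq by (simp add: elementwise_cartesian_def ftr_eq_def)
  have ob: "OM h z \<in> Ob X'" "OM t (OM h z) = OM f z" "OM q' (OM h z) = OM g z" if "z \<in> Ob Z" for z
    using theI'[OF ex1[OF that]] by (auto simp: h_def)
  have mo: "AM h z \<in> Mor X'" "AM t (AM h z) = AM f z" "AM q' (AM h z) = AM g z"
    if "z \<in> Mor Z" for z
    using theI'[OF ex1'[OF that]] by (auto simp: h_def)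
  have ou: "x = OM h z" if "z \<in> Ob Z" "x \<in> Ob X'" "OM t x = OM f z" "OM q' x = OM g z" for x z
    using ex1[OF that(1)] ob[OF that(1)] that by blast
  have mu: "x = AM h z" if "z \<in> Mor Z" "x \<in> Mor X'" "AM t x = AM f z" "AM q' x = AM g z" for x z
    using ex1'[OF that(1)] mo[OF that(1)] that by blast
  note [simp] = ob mo
  have ftr: "is_functor Z X' h"
  proof
    \<comment> \<open>Sources and targets come first: preservation of composites needs to know that
      the images in \<open>X'\<close> are composable.\<close>
    show dom: "Dom X' (AM h k) = OM h (Dom Z k)" if k: "k \<in> Mor Z" for k
      by (rule ou) (use k in \<open>simp_all flip: is_functor.Dom_AM[OF t] is_functor.Dom_AM[OF q']
          is_functor.Dom_AM[OF f] is_functor.Dom_AM[OF g]\<close>)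
    show cod: "Cod X' (AM h k) = OM h (Cod Z k)" if k: "k \<in> Mor Z" for k
      by (rule ou) (use k in \<open>simp_all flip: is_functor.Cod_AM[OF t] is_functor.Cod_AM[OF q']
          is_functor.Cod_AM[OF f] is_functor.Cod_AM[OF g]\<close>)
    show "AM h (Id Z x) = Id X' (OM h x)" if "x \<in> Ob Z" for x
      by (rule mu[symmetric]) (use that in simp_all)
    show "AM h (Comp Z l k) = Comp X' (AM h l) (AM h k)"
      if "k \<in> Mor Z" "l \<in> Mor Z" "Cod Z k = Dom Z l" for k l
      by (rule mu[symmetric]) (use that in \<open>simp_all add: dom cod\<close>)
  qed simp_all
  show thesis
  proof (rule that[OF ftr])
    fix h' assume "is_functor Z X' h'" "ftr_eq Z (t \<circ>\<^sub>F h') f" "ftr_eq Z (q' \<circ>\<^sub>F h') g"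
    then show "ftr_eq Z h' h"
      by (auto simp: ftr_eq_def ftr_facts intro!: ou mu)
  qed (auto simp: ftr_eq_def)
qed

text \<open>Testing the universal property on the fibre product gives \<open>h\<close> from it to
  \<open>X'\<close>, hence solutions over all compatible pairs; testing it on \<open>X'\<close>
  itself shows that \<open>h\<close> retracts the comparison \<open>k\<close>, hence uniqueness. The
  converse is \<open>elementwise_cartesian_lift\<close>.\<close>

lemma (in universe) cartesian_square_iff:
  "cartesian_square small X' X Y' Y t q' q s \<longleftrightarrow>
    small_category small X' \<and> small_category small X \<and>
    small_category small Y' \<and> small_category small Y \<and>
    is_functor X' X t \<and> is_functor X' Y' q' \<and> is_functor X Y q \<and> is_functor Y' Y s \<and>
    ftr_eq X' (q \<circ>\<^sub>F t) (s \<circ>\<^sub>F q') \<and> elementwise_cartesian X' X Y' t q' q s"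
    (is "?C \<longleftrightarrow> ?R")
proof
  assume C: ?C
  then have X': "small_category small X'" and X: "small_category small X"
    and Y': "small_category small Y'"
    and t: "is_functor X' X t" and q': "is_functor X' Y' q'"
    and q: "is_functor X Y q" and s: "is_functor Y' Y s"
    and comm: "ftr_eq X' (q \<circ>\<^sub>F t) (s \<circ>\<^sub>F q')"
    by (auto simp: cartesian_square_def)
  have univ: "\<exists>h. is_functor Z X' h \<and> ftr_eq Z (t \<circ>\<^sub>F h) f \<and> ftr_eq Z (q' \<circ>\<^sub>F h) g \<and>
        (\<forall>h'. is_functor Z X' h' \<and> ftr_eq Z (t \<circ>\<^sub>F h') f \<and> ftr_eq Z (q' \<circ>\<^sub>F h') g \<longrightarrow>
          ftr_eq Z h' h)"
    if "small_category small Z" "is_functor Z X f" "is_functor Z Y' g"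
       "ftr_eq Z (q \<circ>\<^sub>F f) (s \<circ>\<^sub>F g)" for Z f g
    using C that by (simp add: cartesian_square_def)
  let ?P = "fibre_product X Y' q s"
  have "ftr_eq ?P (q \<circ>\<^sub>F ftr_fst) (s \<circ>\<^sub>F ftr_snd)"
    by (auto simp: ftr_eq_def fibre_product_def ftr_fst_def ftr_snd_def)
  then obtain h where h: "is_functor ?P X' h" "ftr_eq ?P (t \<circ>\<^sub>F h) ftr_fst"
      "ftr_eq ?P (q' \<circ>\<^sub>F h) ftr_snd"
    using univ[OF small_category_fibre_product[OF X Y' q s] is_functor_fst is_functor_snd] by blast
  define k where "k = \<lparr>OM = (\<lambda>z. Pr (OM t z) (OM q' z)), AM = (\<lambda>z. Pr (AM t z) (AM q' z))\<rparr>"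
  have k: "is_functor X' ?P k"
    using comm by unfold_locales
      (auto simp: k_def fibre_product_def ftr_facts[OF t] ftr_facts[OF q'] ftr_eq_def)
  have hk: "is_functor X' X' (h \<circ>\<^sub>F k)" by (rule is_functor_comp[OF k h(1)])
  have hk_eq: "ftr_eq X' (t \<circ>\<^sub>F (h \<circ>\<^sub>F k)) t" "ftr_eq X' (q' \<circ>\<^sub>F (h \<circ>\<^sub>F k)) q'"
    using h(2,3) ftr_facts(1,2)[OF k]
    by (auto simp: ftr_eq_def ftr_fst_def ftr_snd_def) (auto simp: k_def)
  \<comment> \<open>\<open>h0\<close> mediates for \<open>X'\<close> with its own projections;
    uniqueness identifies both the composite of \<open>h\<close> after \<open>k\<close> and the
    identity with it.\<close>
  obtain h0 where h0: "\<And>h'. \<lbrakk>is_functor X' X' h'; ftr_eq X' (t \<circ>\<^sub>F h') t;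
      ftr_eq X' (q' \<circ>\<^sub>F h') q'\<rbrakk> \<Longrightarrow> ftr_eq X' h' h0"
    using univ[OF X' t q' comm] by blast
  have "ftr_eq X' (h \<circ>\<^sub>F k) h0" by (rule h0[OF hk hk_eq])
  moreover have "ftr_eq X' ftr_id h0"
    by (rule h0[OF is_functor_id]) (simp_all add: ftr_eq_def)
  ultimately have inv: "\<And>z. z \<in> Ob X' \<Longrightarrow> OM h (Pr (OM t z) (OM q' z)) = z"
    "\<And>m. m \<in> Mor X' \<Longrightarrow> AM h (Pr (AM t m) (AM q' m)) = m"
    by (simp_all add: ftr_eq_def k_def)
  have "elementwise_cartesian X' X Y' t q' q s"
    unfolding elementwise_cartesian_def
  proof (intro conjI ballI impI)
    fix x y assume "x \<in> Ob X" "y \<in> Ob Y'" "OM q x = OM s y"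
    then have P: "Pr x y \<in> Ob ?P" by (simp add: fibre_product_def)
    then have "OM h (Pr x y) \<in> Ob X'" "OM t (OM h (Pr x y)) = x" "OM q' (OM h (Pr x y)) = y"
      using h by (auto simp: ftr_facts[OF h(1)] ftr_eq_def ftr_fst_def ftr_snd_def)
    then show "\<exists>!z. z \<in> Ob X' \<and> OM t z = x \<and> OM q' z = y" using inv(1) by metis
  next
    fix x y assume "x \<in> Mor X" "y \<in> Mor Y'" "AM q x = AM s y"
    then have P: "Pr x y \<in> Mor ?P" by (simp add: fibre_product_def)
    then have "AM h (Pr x y) \<in> Mor X'" "AM t (AM h (Pr x y)) = x" "AM q' (AM h (Pr x y)) = y"
      using h by (auto simp: ftr_facts[OF h(1)] ftr_eq_def ftr_fst_def ftr_snd_def)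
    then show "\<exists>!z. z \<in> Mor X' \<and> AM t z = x \<and> AM q' z = y" using inv(2) by metis
  qed
  with C show ?R by (simp add: cartesian_square_def)
next
  assume R: ?R
  then show ?C
    unfolding cartesian_square_def
  proof (intro conjI allI impI; (elim conjE)?)
    fix Z f g
    assume "small_category small Z" "is_functor Z X f" "is_functor Z Y' g"
      "ftr_eq Z (q \<circ>\<^sub>F f) (s \<circ>\<^sub>F g)"
    then show "\<exists>h. is_functor Z X' h \<and> ftr_eq Z (t \<circ>\<^sub>F h) f \<and> ftr_eq Z (q' \<circ>\<^sub>F h) g \<and>
        (\<forall>h'. is_functor Z X' h' \<and> ftr_eq Z (t \<circ>\<^sub>F h') f \<and> ftr_eq Z (q' \<circ>\<^sub>F h') g \<longrightarrow>
          ftr_eq Z h' h)"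
      using R by (metis elementwise_cartesian_lift[of X' Z] small_categoryD(1))
  qed auto
qed

section \<open>Flipping and pasting of cartesian squares\<close>

lemma elementwise_cartesian_flip:
  assumes "elementwise_cartesian X' X Y' t q' q s"
  shows "elementwise_cartesian X' Y' X q' t s q"
  unfolding elementwise_cartesian_def
proof (intro conjI ballI impI)
  fix x y assume "x \<in> Ob Y'" "y \<in> Ob X" "OM s x = OM q y"
  then have "\<exists>!z. z \<in> Ob X' \<and> OM t z = y \<and> OM q' z = x"
    using assms by (simp add: elementwise_cartesian_def)
  then show "\<exists>!z. z \<in> Ob X' \<and> OM q' z = x \<and> OM t z = y" by (simp only: conj_ac)
next
  fix x y assume "x \<in> Mor Y'" "y \<in> Mor X" "AM s x = AM q y"
  then have "\<exists>!z. z \<in> Mor X' \<and> AM t z = y \<and> AM q' z = x"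
    using assms by (simp add: elementwise_cartesian_def)
  then show "\<exists>!z. z \<in> Mor X' \<and> AM q' z = x \<and> AM t z = y" by (simp only: conj_ac)
qed

lemma (in universe) cartesian_square_flip:
  assumes "cartesian_square small X' X Y' Y t q' q s"
  shows "cartesian_square small X' Y' X Y q' t s q"
  using assms unfolding cartesian_square_iff
  by (auto simp: ftr_eq_def intro: elementwise_cartesian_flip)

lemma (in universe) cartesian_square_fibre_product:
  assumes "small_category small X" "small_category small Y'" "small_category small Y"
    "is_functor X Y q" "is_functor Y' Y s"
  shows "cartesian_square small (fibre_product X Y' q s) X Y' Y ftr_fst ftr_snd q s"
  using assms unfolding cartesian_square_iff
  by (auto simp: small_category_fibre_product is_functor_fst is_functor_snd
      elementwise_cartesian_fibre_product)
    (auto simp: ftr_eq_def fibre_product_def ftr_fst_def ftr_snd_def)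

text \<open>A solution over \<open>(x, z)\<close> is found in two steps: first \<open>y\<close> in
  \<open>Y''\<close> over \<open>(q(x), z)\<close>, then an element of \<open>X''\<close> over
  \<open>(x, y)\<close>.\<close>

lemma elementwise_cartesian_paste:
  assumes 1: "elementwise_cartesian X'' X Y'' t q'' q s"
    and 2: "elementwise_cartesian Y'' Y Z'' s r'' r w"
    and q: "is_functor X Y q" and q'': "is_functor X'' Y'' q''"
    and eq: "ftr_eq X'' (q \<circ>\<^sub>F t) (s \<circ>\<^sub>F q'')"
  shows "elementwise_cartesian X'' X Z'' t (r'' \<circ>\<^sub>F q'') (r \<circ>\<^sub>F q) w"
  unfolding elementwise_cartesian_def
proof (intro conjI ballI impI)
  fix x z assume x: "x \<in> Ob X" "z \<in> Ob Z''" "OM (r \<circ>\<^sub>F q) x = OM w z"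
  then have y_ex: "\<exists>!y. y \<in> Ob Y'' \<and> OM s y = OM q x \<and> OM r'' y = z"
    using 2 by (simp add: elementwise_cartesian_def ftr_facts[OF q])
  then obtain y where y: "y \<in> Ob Y''" "OM s y = OM q x" "OM r'' y = z" by blast
  then have ex: "\<exists>!v. v \<in> Ob X'' \<and> OM t v = x \<and> OM q'' v = y"
    using 1 x by (simp add: elementwise_cartesian_def)
  \<comment> \<open>For uniqueness, commutativity puts \<open>q''(v)\<close> over
    \<open>q(x)\<close>, so it solves the same problem as \<open>y\<close>.\<close>
  have "OM q'' v = y" if "v \<in> Ob X''" "OM t v = x" "OM r'' (OM q'' v) = z" for v
  proof -
    have "OM s (OM q'' v) = OM q x" using eq that by (auto simp: ftr_eq_def)
    then show ?thesis using y_ex y that is_functor.OM_Ob[OF q''] by blast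
  qed
  with ex y show "\<exists>!v. v \<in> Ob X'' \<and> OM t v = x \<and> OM (r'' \<circ>\<^sub>F q'') v = z" by auto
next
  fix x z assume x: "x \<in> Mor X" "z \<in> Mor Z''" "AM (r \<circ>\<^sub>F q) x = AM w z"
  then have y_ex: "\<exists>!y. y \<in> Mor Y'' \<and> AM s y = AM q x \<and> AM r'' y = z"
    using 2 by (simp add: elementwise_cartesian_def ftr_facts[OF q])
  then obtain y where y: "y \<in> Mor Y''" "AM s y = AM q x" "AM r'' y = z" by blast
  then have ex: "\<exists>!v. v \<in> Mor X'' \<and> AM t v = x \<and> AM q'' v = y"
    using 1 x by (simp add: elementwise_cartesian_def)
  have "AM q'' v = y" if "v \<in> Mor X''" "AM t v = x" "AM r'' (AM q'' v) = z" for v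
  proof -
    have "AM s (AM q'' v) = AM q x" using eq that by (auto simp: ftr_eq_def)
    then show ?thesis using y_ex y that is_functor.AM_Mor[OF q''] by blast
  qed
  with ex y show "\<exists>!v. v \<in> Mor X'' \<and> AM t v = x \<and> AM (r'' \<circ>\<^sub>F q'') v = z" by auto
qed

lemma (in universe) cartesian_square_paste:
  assumes "cartesian_square small X'' X Y'' Y t q'' q s"
    and "cartesian_square small Y'' Y Z'' Z s r'' r w"
  shows "cartesian_square small X'' X Z'' Z t (r'' \<circ>\<^sub>F q'') (r \<circ>\<^sub>F q) w"
proof -
  have "ftr_eq X'' ((r \<circ>\<^sub>F q) \<circ>\<^sub>F t) (w \<circ>\<^sub>F (r'' \<circ>\<^sub>F q''))"
    using assms unfolding cartesian_square_iff ftr_eq_def ftr_comp_sel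
    by (metis is_functor.OM_Ob is_functor.AM_Mor)
  with assms show ?thesis
    unfolding cartesian_square_iff
    by (auto intro: is_functor_comp elementwise_cartesian_paste)
qed

subsection \<open>Slices\<close>

lemma slice_sel [simp]:
  "Dom (slice A B u b) = lsrc"
  "Cod (slice A B u b) = ltgt"
  "Id (slice A B u b) x = Lab x (Id A (pfst x)) x"
  "Comp (slice A B u b) n m = Lab (lsrc m) (Comp A (lab n) (lab m)) (ltgt n)"
  by (simp_all add: slice_def)

lemma Pr_Ob_slice [simp]:
  "Pr a p \<in> Ob (slice A B u b) \<longleftrightarrow>
    a \<in> Ob A \<and> p \<in> Mor B \<and> Dom B p = OM u a \<and> Cod B p = b"
  by (simp add: slice_def)

lemma Lab_Mor_slice [simp]:
  "Lab (Pr a p) f (Pr a' p') \<in> Mor (slice A B u b) \<longleftrightarrow>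
    Pr a p \<in> Ob (slice A B u b) \<and> Pr a' p' \<in> Ob (slice A B u b) \<and>
    f \<in> Mor A \<and> Dom A f = a \<and> Cod A f = a' \<and> Comp B p' (AM u f) = p"
  by (auto simp: slice_def)

lemma Ob_sliceE:
  assumes "x \<in> Ob (slice A B u b)"
  obtains a p where "x = Pr a p" "a \<in> Ob A" "p \<in> Mor B" "Dom B p = OM u a" "Cod B p = b"
  using assms by (auto simp: slice_def)

lemma Mor_sliceE:
  assumes "m \<in> Mor (slice A B u b)"
  obtains a p f a' p' where "m = Lab (Pr a p) f (Pr a' p')"
    "a \<in> Ob A" "p \<in> Mor B" "Dom B p = OM u a" "Cod B p = b"
    "a' \<in> Ob A" "p' \<in> Mor B" "Dom B p' = OM u a'" "Cod B p' = b"
    "f \<in> Mor A" "Dom A f = a" "Cod A f = a'" "Comp B p' (AM u f) = p"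
  using assms by (auto simp: slice_def)

lemma category_slice:
  assumes A: "category A" and B: "category B" and u: "is_functor A B u"
  shows "category (slice A B u b)"
proof -
  let ?S = "slice A B u b"
  note a = cat_facts[OF A] and b = cat_facts[OF B] and f = ftr_facts[OF u]
  show ?thesis
  proof
    show "Comp ?S n m \<in> Mor ?S" if "m \<in> Mor ?S" "n \<in> Mor ?S" "Cod ?S m = Dom ?S n" for m n
    proof -
      from that(1) obtain x p k x' p' where m: "m = Lab (Pr x p) k (Pr x' p')"
          "x \<in> Ob A" "p \<in> Mor B" "Dom B p = OM u x" "Cod B p = b"
          "p' \<in> Mor B" "Dom B p' = OM u x'"
          "k \<in> Mor A" "Dom A k = x" "Cod A k = x'" "Comp B p' (AM u k) = p"
        by (rule Mor_sliceE)
      from that(2) obtain y q l y' q' where n: "n = Lab (Pr y q) l (Pr y' q')"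
          "y' \<in> Ob A" "q' \<in> Mor B" "Dom B q' = OM u y'" "Cod B q' = b"
          "l \<in> Mor A" "Dom A l = y" "Cod A l = y'" "Comp B q' (AM u l) = q"
        by (rule Mor_sliceE)
      have "y = x'" "q = p'" using that(3) m(1) n(1) by auto
      then have "Comp B q' (AM u (Comp A l k)) = Comp B (Comp B q' (AM u l)) (AM u k)"
        using m n by (simp add: f b)
      with m n \<open>y = x'\<close> \<open>q = p'\<close> show ?thesis by (simp add: a)
    qed
    show "Id ?S x \<in> Mor ?S" if "x \<in> Ob ?S" for x
      using that b(9) by (auto elim!: Ob_sliceE simp: a f) metis
  qed (auto elim!: Mor_sliceE Ob_sliceE simp: a)
qed

lemma (in universe) small_category_slice:
  assumes A: "small_category small A" and B: "small_category small B" and u: "is_functor A B u"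
  shows "small_category small (slice A B u b)"
  unfolding small_category_def
proof (intro conjI)
  note a = small_categoryD[OF A] small_categoryD[OF B]
  show "category (slice A B u b)" by (rule category_slice[OF a(1,4) u])
  show ob: "small (Ob (slice A B u b))"
    by (rule small_subset[OF small_Pr[OF a(2,6)]]) (auto elim!: Ob_sliceE)
  show "small (Mor (slice A B u b))"
    by (rule small_subset[OF small_Lab[OF ob a(3) ob]]) (auto elim!: Mor_sliceE)
qed

section \<open>Functors between slices and final objects of slices\<close>

definition slice_map :: "'a ftr \<Rightarrow> 'a ftr \<Rightarrow> 'a ftr" where
  "slice_map t s =
    (let om = (\<lambda>y. Pr (OM t (pfst y)) (AM s (psnd y))) in
     \<lparr>OM = om, AM = (\<lambda>m. Lab (om (lsrc m)) (AM t (lab m)) (om (ltgt m)))\<rparr>)"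

lemma slice_map_sel [simp]:
  "OM (slice_map t s) y = Pr (OM t (pfst y)) (AM s (psnd y))"
  "AM (slice_map t s) m =
    Lab (OM (slice_map t s) (lsrc m)) (AM t (lab m)) (OM (slice_map t s) (ltgt m))"
  by (simp_all add: slice_map_def)

lemma base_change_eq: "base_change t s = slice_map (groth_map t) s"
  by (simp add: base_change_def slice_map_def)

text \<open>Applying \<open>s\<close> to a triangle over \<open>y\<close> and replacing
  \<open>s q'\<close> by \<open>q t\<close> gives a triangle over \<open>s(y)\<close>. With
  \<open>s = ftr_id\<close> this compares slices over one base object; with
  \<open>groth_map t\<close> for \<open>t\<close> it is \<open>base_change\<close>.\<close>

lemma is_functor_slice_map:
  assumes X': "category X'" and t: "is_functor X' X t" and q': "is_functor X' Y' q'"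
    and q: "is_functor X Y q" and s: "is_functor Y' Y s"
    and eq: "ftr_eq X' (q \<circ>\<^sub>F t) (s \<circ>\<^sub>F q')"
  shows "is_functor (slice X' Y' q' y) (slice X Y q (OM s y)) (slice_map t s)"
proof -
  note [simp] = cat_facts[OF X'] ftr_facts[OF t] ftr_facts[OF q] ftr_facts[OF q'] ftr_facts[OF s]
  have [simp]: "OM q (OM t x) = OM s (OM q' x)" if "x \<in> Ob X'" for x
    using eq that by (simp add: ftr_eq_def)
  have [simp]: "AM q (AM t x) = AM s (AM q' x)" if "x \<in> Mor X'" for x
    using eq that by (simp add: ftr_eq_def)
  show ?thesis
    by unfold_locales
      (auto elim!: Ob_sliceE Mor_sliceE simp flip: is_functor.AM_Comp[OF s])
qed

text \<open>An arrow of the slice from \<open>Pr a r\<close> to \<open>Pr x p\<close> is determined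
  by its label, so finality is unique factorisation of every \<open>r\<close> through
  \<open>p\<close>. This criterion lies behind all final objects constructed below.\<close>

lemma final_object_slice:
  assumes "x \<in> Ob A" "p \<in> Mor B" "Dom B p = OM u x" "Cod B p = b"
    and "\<And>a r. \<lbrakk>a \<in> Ob A; r \<in> Mor B; Dom B r = OM u a; Cod B r = b\<rbrakk>
      \<Longrightarrow> \<exists>!f. f \<in> Mor A \<and> Dom A f = a \<and> Cod A f = x \<and> Comp B p (AM u f) = r"
  shows "final_object (slice A B u b) (Pr x p)"
  unfolding final_object_def
proof (intro conjI ballI)
  fix y assume "y \<in> Ob (slice A B u b)"
  then obtain a r where y: "y = Pr a r" "a \<in> Ob A" "r \<in> Mor B" "Dom B r = OM u a" "Cod B r = b"
    by (rule Ob_sliceE)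
  obtain f where f: "f \<in> Mor A" "Dom A f = a" "Cod A f = x" "Comp B p (AM u f) = r"
    and uniq: "\<And>f'. \<lbrakk>f' \<in> Mor A; Dom A f' = a; Cod A f' = x; Comp B p (AM u f') = r\<rbrakk> \<Longrightarrow> f' = f"
    using assms(5)[OF y(2-5)] by blast
  show "\<exists>!m. m \<in> Mor (slice A B u b) \<and> Dom (slice A B u b) m = y \<and> Cod (slice A B u b) m = Pr x p"
    by (rule ex1I[of _ "Lab y f (Pr x p)"])
      (use assms(1-4) y f in \<open>auto elim!: Mor_sliceE intro: uniq\<close>)
qed (use assms(1-4) in simp)

section \<open>Transport of membership along surjective equivalences\<close>

definition surjective_equivalence :: "'a cat \<Rightarrow> 'a cat \<Rightarrow> 'a ftr \<Rightarrow> bool" where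
  "surjective_equivalence X Y h \<longleftrightarrow> is_functor X Y h \<and>
    (\<forall>y\<in>Ob Y. \<exists>x\<in>Ob X. OM h x = y) \<and>
    (\<forall>x\<in>Ob X. \<forall>x'\<in>Ob X. \<forall>g\<in>Mor Y. Dom Y g = OM h x \<and> Cod Y g = OM h x' \<longrightarrow>
      (\<exists>!f. f \<in> Mor X \<and> Dom X f = x \<and> Cod X f = x' \<and> AM h f = g))"

text \<open>If \<open>h(x) = y\<close>, full faithfulness makes \<open>Pr x (Id Y y)\<close> final
  in the slice over \<open>y\<close>; so all slices are in \<open>\<A>\<close> and the closure axiom
  applies. Membership passes from target to source, so the direction of \<open>h\<close> matters in
  each application.\<close>

lemma mem_of_surjective_equivalence:
  assumes A: "right_asphericity_structure small \<A>"
    and X: "small_category small X" and Y: "small_category small Y"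
    and h: "surjective_equivalence X Y h" and mem: "Y \<in> \<A>" and "universe small"
  shows "X \<in> \<A>"
proof -
  interpret universe small by fact
  have f: "is_functor X Y h" using h by (simp add: surjective_equivalence_def)
  note Xc = cat_facts[OF small_categoryD(1)[OF X]] and Yc = cat_facts[OF small_categoryD(1)[OF Y]]
  have "slice X Y h y \<in> \<A>" if y: "y \<in> Ob Y" for y
  proof -
    obtain x where x: "x \<in> Ob X" "OM h x = y"
      using h y by (auto simp: surjective_equivalence_def)
    have "final_object (slice X Y h y) (Pr x (Id Y y))"
    proof (rule final_object_slice)
      fix a r assume a: "a \<in> Ob X" "r \<in> Mor Y" "Dom Y r = OM h a" "Cod Y r = y"
      have "Comp Y (Id Y y) (AM h f) = AM h f" if "f \<in> Mor X" "Cod X f = x" for f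
        using Yc(10)[of "AM h f"] that x ftr_facts(2,4)[OF f, of f] by simp
      moreover have "\<exists>!f. f \<in> Mor X \<and> Dom X f = a \<and> Cod X f = x \<and> AM h f = r"
        using h a x by (simp add: surjective_equivalence_def)
      ultimately show "\<exists>!f. f \<in> Mor X \<and> Dom X f = a \<and> Cod X f = x \<and>
          Comp Y (Id Y y) (AM h f) = r"
        by metis
    qed (use x y in \<open>auto simp: Yc\<close>)
    then show ?thesis
      using A small_category_slice[OF X Y f] unfolding right_asphericity_structure_def by blast
  qed
  with A X Y f mem show ?thesis unfolding right_asphericity_structure_def by blast
qed

text \<open>An object \<open>Pr b r\<close> lifts to \<open>Pr a r\<close> with
  \<open>h(a) = b\<close> and the same \<open>r\<close>; an arrow lifts through its label, the
  triangles agreeing because \<open>q h = p\<close>.\<close>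

lemma surjective_equivalence_slice:
  assumes X: "category X" and Y: "category Y" and Z: "category Z"
    and h: "surjective_equivalence X Y h" and p: "is_functor X Z p" and q: "is_functor Y Z q"
    and eq: "ftr_eq X (q \<circ>\<^sub>F h) p"
  shows "surjective_equivalence (slice X Z p z) (slice Y Z q z) (slice_map h ftr_id)"
proof -
  have f: "is_functor X Y h" using h by (simp add: surjective_equivalence_def)
  have eq': "ftr_eq X (q \<circ>\<^sub>F h) (ftr_id \<circ>\<^sub>F p)" using eq by (simp add: ftr_eq_def)
  show ?thesis
    unfolding surjective_equivalence_def
  proof (intro conjI ballI impI)
    show "is_functor (slice X Z p z) (slice Y Z q z) (slice_map h ftr_id)"
      using is_functor_slice_map[OF X f p q is_functor_id eq'] by simp
    fix y assume "y \<in> Ob (slice Y Z q z)"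
    then obtain b r where y: "y = Pr b r" "b \<in> Ob Y" "r \<in> Mor Z" "Dom Z r = OM q b" "Cod Z r = z"
      by (rule Ob_sliceE)
    then obtain a where "a \<in> Ob X" "OM h a = b"
      using h by (auto simp: surjective_equivalence_def)
    then show "\<exists>x\<in>Ob (slice X Z p z). OM (slice_map h ftr_id) x = y"
      using y eq by (intro bexI[of _ "Pr a r"]) (auto simp: ftr_eq_def)
  next
    fix x x' g
    assume x: "x \<in> Ob (slice X Z p z)" "x' \<in> Ob (slice X Z p z)"
      and g: "g \<in> Mor (slice Y Z q z)"
        "Dom (slice Y Z q z) g = OM (slice_map h ftr_id) x \<and>
          Cod (slice Y Z q z) g = OM (slice_map h ftr_id) x'"
    obtain a r where xa: "x = Pr a r" "a \<in> Ob X" by (rule Ob_sliceE[OF x(1)])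
    obtain a' r' where xa': "x' = Pr a' r'" "a' \<in> Ob X" by (rule Ob_sliceE[OF x(2)])
    obtain k where k: "g = Lab (Pr (OM h a) r) k (Pr (OM h a') r')" "k \<in> Mor Y"
        "Dom Y k = OM h a" "Cod Y k = OM h a'" "Comp Z r' (AM q k) = r"
      by (rule Mor_sliceE[OF g(1)]) (use g(2) xa xa' in simp)
    have "\<exists>!l. l \<in> Mor X \<and> Dom X l = a \<and> Cod X l = a' \<and> AM h l = k"
      using h xa(2) xa'(2) k(2-4) by (simp add: surjective_equivalence_def)
    then obtain l where l: "l \<in> Mor X" "Dom X l = a" "Cod X l = a'" "AM h l = k"
      and uniq: "\<And>l'. \<lbrakk>l' \<in> Mor X; Dom X l' = a; Cod X l' = a'; AM h l' = k\<rbrakk> \<Longrightarrow> l' = l"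
      by blast
    have pl: "AM p l = AM q k" using eq l by (auto simp: ftr_eq_def)
    show "\<exists>!m. m \<in> Mor (slice X Z p z) \<and> Dom (slice X Z p z) m = x \<and>
        Cod (slice X Z p z) m = x' \<and> AM (slice_map h ftr_id) m = g"
    proof (intro ex1I[of _ "Lab x l x'"] conjI; (elim conjE)?)
      show "Lab x l x' \<in> Mor (slice X Z p z)" using x l pl k(5) by (simp add: xa(1) xa'(1))
      fix m assume m: "m \<in> Mor (slice X Z p z)" "Dom (slice X Z p z) m = x"
        "Cod (slice X Z p z) m = x'" "AM (slice_map h ftr_id) m = g"
      show "m = Lab x l x'"
        by (rule Mor_sliceE[OF m(1)]) (use m(2-4) k(1) xa(1) xa'(1) in \<open>simp add: uniq\<close>)
    qed (use k l xa xa' in simp_all)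
  qed
qed

subsection \<open>The right cone on a category\<close>

abbreviation apex :: "'a elt" where
  "apex \<equiv> Atom undefined"

text \<open>Objects and arrows \<open>c\<close> of \<open>E\<close> are renamed \<open>Pr apex c\<close>, which keeps them apart from the new
  final object; the arrow from \<open>x\<close> to \<open>apex\<close> is \<open>Lab x apex apex\<close>.\<close>

definition right_cone :: "'a cat \<Rightarrow> 'a cat" where
  "right_cone E = \<lparr>
    Ob = insert apex (Pr apex ` Ob E),
    Mor = Pr apex ` Mor E \<union> (\<lambda>x. Lab x apex apex) ` insert apex (Pr apex ` Ob E),
    Dom = (\<lambda>m. case m of Pr _ f \<Rightarrow> Pr apex (Dom E f) | Lab x _ _ \<Rightarrow> x | Atom _ \<Rightarrow> apex),
    Cod = (\<lambda>m. case m of Pr _ f \<Rightarrow> Pr apex (Cod E f) | _ \<Rightarrow> apex),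
    Id = (\<lambda>x. case x of Pr _ c \<Rightarrow> Pr apex (Id E c) | _ \<Rightarrow> Lab apex apex apex),
    Comp = (\<lambda>n m. case n of
        Pr _ g \<Rightarrow> Pr apex (Comp E g (psnd m))
      | _ \<Rightarrow> Lab (case m of Pr _ f \<Rightarrow> Pr apex (Dom E f) | Lab x _ _ \<Rightarrow> x | Atom _ \<Rightarrow> apex)
          apex apex)\<rparr>"

definition cone_incl :: "'a ftr" where
  "cone_incl = \<lparr>OM = Pr apex, AM = Pr apex\<rparr>"

text \<open>A functor out of the right cone amounts to a functor \<open>g\<close> on
  \<open>E\<close> with a cocone \<open>\<gamma>\<close> from \<open>g\<close> to the value
  \<open>y\<close> at the apex.\<close>

definition cone_ftr :: "'a cat \<Rightarrow> 'a ftr \<Rightarrow> 'a elt \<Rightarrow> ('a elt \<Rightarrow> 'a elt) \<Rightarrow> 'a ftr" where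
  "cone_ftr Y g y \<gamma> = \<lparr>
    OM = (\<lambda>x. case x of Pr _ c \<Rightarrow> OM g c | _ \<Rightarrow> y),
    AM = (\<lambda>m. case m of Pr _ f \<Rightarrow> AM g f
      | Lab x _ _ \<Rightarrow> (case x of Pr _ c \<Rightarrow> \<gamma> c | _ \<Rightarrow> Id Y y) | Atom _ \<Rightarrow> Id Y y)\<rparr>"

lemma right_cone_sel [simp]:
  "Pr z c \<in> Ob (right_cone E) \<longleftrightarrow> z = apex \<and> c \<in> Ob E"
  "Atom w \<in> Ob (right_cone E) \<longleftrightarrow> w = undefined"
  "Lab x a b \<notin> Ob (right_cone E)"
  "Pr z f \<in> Mor (right_cone E) \<longleftrightarrow> z = apex \<and> f \<in> Mor E"
  "Lab x a b \<in> Mor (right_cone E) \<longleftrightarrow> a = apex \<and> b = apex \<and> x \<in> Ob (right_cone E)"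
  "Atom w \<notin> Mor (right_cone E)"
  "Dom (right_cone E) (Pr z f) = Pr apex (Dom E f)"
  "Dom (right_cone E) (Lab x a b) = x"
  "Cod (right_cone E) (Pr z f) = Pr apex (Cod E f)"
  "Cod (right_cone E) (Lab x a b) = apex"
  "Id (right_cone E) (Pr z c) = Pr apex (Id E c)"
  "Id (right_cone E) (Atom w) = Lab apex apex apex"
  "Comp (right_cone E) (Pr z g) (Pr z' f) = Pr apex (Comp E g f)"
  "Comp (right_cone E) (Lab x a b) m = Lab (Dom (right_cone E) m) apex apex"
  by (auto simp: right_cone_def split: elt.splits)

lemma cone_incl_sel [simp]: "OM cone_incl c = Pr apex c" "AM cone_incl f = Pr apex f"
  by (simp_all add: cone_incl_def)

lemma cone_ftr_sel [simp]:
  "OM (cone_ftr Y g y \<gamma>) (Pr z c) = OM g c"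
  "OM (cone_ftr Y g y \<gamma>) (Atom w) = y"
  "AM (cone_ftr Y g y \<gamma>) (Pr z f) = AM g f"
  "AM (cone_ftr Y g y \<gamma>) (Lab (Pr z c) a b) = \<gamma> c"
  "AM (cone_ftr Y g y \<gamma>) (Lab (Atom w) a b) = Id Y y"
  by (simp_all add: cone_ftr_def)

lemma Ob_right_coneE:
  assumes "x \<in> Ob (right_cone E)"
  obtains "x = apex" | c where "x = Pr apex c" "c \<in> Ob E"
  using assms by (auto simp: right_cone_def)

lemma Mor_right_coneE:
  assumes "m \<in> Mor (right_cone E)"
  obtains "m = Lab apex apex apex" | c where "m = Lab (Pr apex c) apex apex" "c \<in> Ob E"
    | f where "m = Pr apex f" "f \<in> Mor E"
  using assms by (auto simp: right_cone_def)

lemma category_right_cone: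
  assumes E: "category E"
  shows "category (right_cone E)"
  by unfold_locales
    (auto elim!: Ob_right_coneE Mor_right_coneE simp: cat_facts[OF E])

lemma (in universe) small_category_right_cone:
  assumes E: "small_category small E"
  shows "small_category small (right_cone E)"
  using small_categoryD[OF E] unfolding small_category_def
  by (auto intro!: category_right_cone)
    (auto simp: right_cone_def intro!: small_insert small_Un small_image)

lemma is_functor_cone_incl: "is_functor E (right_cone E) cone_incl"
  by unfold_locales auto

text \<open>The hypotheses on \<open>\<gamma>\<close> make it a cocone; naturality is what
  composites of a new arrow after an arrow of \<open>E\<close> require.\<close>

lemma is_functor_cone_ftr:
  assumes E: "category E" and Y: "category Y" and g: "is_functor E Y g" and y: "y \<in> Ob Y"
    and \<gamma>: "\<And>c. c \<in> Ob E \<Longrightarrow> \<gamma> c \<in> Mor Y \<and> Dom Y (\<gamma> c) = OM g c \<and> Cod Y (\<gamma> c) = y"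
    and nat: "\<And>f. f \<in> Mor E \<Longrightarrow> Comp Y (\<gamma> (Cod E f)) (AM g f) = \<gamma> (Dom E f)"
  shows "is_functor (right_cone E) Y (cone_ftr Y g y \<gamma>)"
proof -
  \<comment> \<open>Composites with the identity of the apex go to composites with
    \<open>Id Y y\<close>, so these unit laws are supplied.\<close>
  have [simp]: "Comp Y (Id Y y) (\<gamma> c) = \<gamma> c" if "c \<in> Ob E" for c
    using cat_facts(10)[OF Y, of "\<gamma> c"] \<gamma>[OF that] by simp
  have [simp]: "Comp Y (Id Y y) (Id Y y) = Id Y y"
    using cat_facts(10)[OF Y, of "Id Y y"] y by (simp add: cat_facts[OF Y])
  show ?thesis
    by unfold_locales
      (auto elim!: Ob_right_coneE Mor_right_coneE
        simp: cat_facts(1-5)[OF E] cat_facts(3-5)[OF Y] ftr_facts[OF g] y \<gamma> nat)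
qed

text \<open>Every slice of the inclusion has a final object: over the apex it is a copy of
  \<open>E\<close>, with final object given by \<open>e\<close>; over an object \<open>c\<close> of
  \<open>E\<close> it is a copy of \<open>E/c\<close>, where the identity of \<open>c\<close> is
  final.\<close>

lemma aspheric_cone_incl:
  assumes A: "right_asphericity_structure small \<A>" and "universe small"
    and E: "small_category small E" and e: "final_object E e"
  shows "aspheric \<A> E (right_cone E) cone_incl"
  unfolding aspheric_def
proof
  interpret universe small by fact
  have Ec: "category E" by (rule small_categoryD(1)[OF E])
  fix j assume "j \<in> Ob (right_cone E)"
  then have "\<exists>x. final_object (slice E (right_cone E) cone_incl j) x"
  proof (cases rule: Ob_right_coneE)
    case 1
    have "final_object (slice E (right_cone E) cone_incl j) (Pr e (Lab (Pr apex e) apex apex))"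
    proof (rule final_object_slice)
      fix a r assume a: "a \<in> Ob E" "r \<in> Mor (right_cone E)"
        "Dom (right_cone E) r = OM cone_incl a" "Cod (right_cone E) r = j"
      from a(2) have r: "r = Lab (Pr apex a) apex apex"
        by (cases rule: Mor_right_coneE) (use a(3,4) 1 in auto)
      \<comment> \<open>There is a single arrow from \<open>Pr apex a\<close> to
        \<open>apex\<close>, so the triangle condition is automatic and finality of \<open>e\<close>
        decides.\<close>
      have "\<exists>!f. f \<in> Mor E \<and> Dom E f = a \<and> Cod E f = e"
        using e a(1) by (simp add: final_object_def)
      then show "\<exists>!f. f \<in> Mor E \<and> Dom E f = a \<and> Cod E f = e \<and>
          Comp (right_cone E) (Lab (Pr apex e) apex apex) (AM cone_incl f) = r"
        unfolding r by auto
    qed (use e 1 in \<open>auto simp: final_object_def\<close>)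
    then show ?thesis by blast
  next
    case (2 c)
    have "final_object (slice E (right_cone E) cone_incl j) (Pr c (Pr apex (Id E c)))"
    proof (rule final_object_slice)
      fix a r assume a: "a \<in> Ob E" "r \<in> Mor (right_cone E)"
        "Dom (right_cone E) r = OM cone_incl a" "Cod (right_cone E) r = j"
      \<comment> \<open>New arrows all end at the apex, so \<open>r\<close> comes from
        \<open>E\<close>.\<close>
      from a(2) obtain f where f: "r = Pr apex f" "f \<in> Mor E"
        by (cases rule: Mor_right_coneE) (use a(4) 2 in auto)
      have id: "Comp E (Id E c) f = f" if "f \<in> Mor E" "Cod E f = c" for f
        using cat_facts(10)[OF Ec, of f] that by simp
      show "\<exists>!f. f \<in> Mor E \<and> Dom E f = a \<and> Cod E f = c \<and>
          Comp (right_cone E) (Pr apex (Id E c)) (AM cone_incl f) = r"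
        by (rule ex1I[of _ f]) (use a(3,4) f 2 id in \<open>simp_all, metis\<close>)
    qed (use 2 in \<open>auto simp: cat_facts[OF Ec]\<close>)
    then show ?thesis by blast
  qed
  then show "slice E (right_cone E) cone_incl j \<in> \<A>"
    using A small_category_slice[OF E small_category_right_cone[OF E] is_functor_cone_incl]
    unfolding right_asphericity_structure_def by blast
qed

subsection \<open>Base change along a smooth functor\<close>

definition slice_proj :: "'a ftr" where
  "slice_proj = \<lparr>OM = pfst, AM = lab\<rparr>"

lemma slice_proj_sel [simp]: "OM slice_proj x = pfst x" "AM slice_proj m = lab m"
  by (simp_all add: slice_proj_def)

lemma is_functor_slice_proj: "is_functor (slice A B u b) A slice_proj"
  by unfold_locales (auto elim!: Ob_sliceE Mor_sliceE)

text \<open>An arrow into \<open>x\<close> factors through \<open>Id X x\<close> only as itself.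
  This finality feeds \<open>aspheric_cone_incl\<close>.\<close>

lemma final_object_slice_id:
  assumes X: "category X" and x: "x \<in> Ob X"
  shows "final_object (slice X X ftr_id x) (Pr x (Id X x))"
proof (rule final_object_slice)
  fix a r assume "r \<in> Mor X" "Dom X r = OM ftr_id a" "Cod X r = x"
  then show "\<exists>!f. f \<in> Mor X \<and> Dom X f = a \<and> Cod X f = x \<and> Comp X (Id X x) (AM ftr_id f) = r"
    using cat_facts(10)[OF X] by (intro ex1I[of _ r]) (auto, metis)
qed (use x in \<open>simp_all add: cat_facts[OF X]\<close>)

lemma fibre_product_sel:
  "Pr a b \<in> Ob (fibre_product X Y q s) \<longleftrightarrow> a \<in> Ob X \<and> b \<in> Ob Y \<and> OM q a = OM s b"
  "Pr f g \<in> Mor (fibre_product X Y q s) \<longleftrightarrow> f \<in> Mor X \<and> g \<in> Mor Y \<and> AM q f = AM s g"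
  "Dom (fibre_product X Y q s) (Pr f g) = Pr (Dom X f) (Dom Y g)"
  "Cod (fibre_product X Y q s) (Pr f g) = Pr (Cod X f) (Cod Y g)"
  "Comp (fibre_product X Y q s) (Pr f' g') (Pr f g) = Pr (Comp X f' f) (Comp Y g' g)"
  by (simp_all add: fibre_product_def)

text \<open>The context fixes a square over \<open>s\<close>, an object \<open>y\<close> of
  \<open>Y'\<close> and an object \<open>Pr x p\<close> of the slice of \<open>q\<close> over
  \<open>s(y)\<close>; it serves to study the slice of \<open>slice_map t s\<close> over that
  object.\<close>

locale cartesian_fibre = universe small for small :: "'a elt set \<Rightarrow> bool" +
  fixes X' X Y' Y :: "'a cat" and t q' q s :: "'a ftr" and x p y :: "'a elt"
  assumes cart: "cartesian_square small X' X Y' Y t q' q s"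
    and x: "x \<in> Ob X" and p: "p \<in> Mor Y" "Dom Y p = OM q x" "Cod Y p = OM s y"
    and y: "y \<in> Ob Y'"
begin

lemma small_cats:
  "small_category small X'" "small_category small X" "small_category small Y'"
  "small_category small Y"
  using cart by (simp_all add: cartesian_square_iff)

lemmas X' = small_categoryD(1)[OF small_cats(1)]
lemmas X = small_categoryD(1)[OF small_cats(2)]
lemmas Y' = small_categoryD(1)[OF small_cats(3)]
lemmas Y = small_categoryD(1)[OF small_cats(4)]

lemma functors: "is_functor X' X t" "is_functor X' Y' q'" "is_functor X Y q" "is_functor Y' Y s"
  using cart by (simp_all add: cartesian_square_iff)

lemmas t = ftr_facts[OF functors(1)]
lemmas q' = ftr_facts[OF functors(2)]
lemmas q = ftr_facts[OF functors(3)]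
lemmas s = ftr_facts[OF functors(4)]

lemma commutes: "ftr_eq X' (q \<circ>\<^sub>F t) (s \<circ>\<^sub>F q')"
  using cart by (simp add: cartesian_square_iff)

lemma commutes_Ob: "z \<in> Ob X' \<Longrightarrow> OM q (OM t z) = OM s (OM q' z)"
  and commutes_Mor: "m \<in> Mor X' \<Longrightarrow> AM q (AM t m) = AM s (AM q' m)"
  using commutes by (simp_all add: ftr_eq_def)

abbreviation E :: "'a cat" where
  "E \<equiv> slice X X ftr_id x"

abbreviation J :: "'a cat" where
  "J \<equiv> right_cone E"

text \<open>For \<open>c = Pr a f\<close> the entry \<open>psnd c\<close> is the structure arrow
  \<open>f\<close> from \<open>a\<close> to \<open>x\<close>, so the cocone component is
  \<open>q(f)\<close> followed by \<open>p\<close>, from \<open>q(a)\<close> to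
  \<open>s(y)\<close>.\<close>

definition k :: "'a ftr" where
  "k = cone_ftr Y (q \<circ>\<^sub>F slice_proj) (OM s y) (\<lambda>c. Comp Y p (AM q (psnd c)))"

abbreviation P :: "'a cat" where
  "P \<equiv> fibre_product J Y' k s"

text \<open>By \<open>cartesian_Q\<close> this is the part of \<open>P\<close> lying over
  \<open>E\<close> inside \<open>J\<close>.\<close>

abbreviation Q :: "'a cat" where
  "Q \<equiv> slice X' X t x"

text \<open>The pullback of \<open>cone_incl\<close> along the projection from \<open>P\<close> to
  \<open>J\<close>; smoothness will make it aspheric.\<close>

definition v :: "'a ftr" where
  "v = \<lparr>OM = (\<lambda>z. Pr (Pr apex (OM (slice_map t ftr_id) z)) (OM q' (pfst z))),
    AM = (\<lambda>m. Pr (Pr apex (AM (slice_map t ftr_id) m)) (AM q' (lab m)))\<rparr>"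

lemma v_sel [simp]:
  "OM v z = Pr (Pr apex (OM (slice_map t ftr_id) z)) (OM q' (pfst z))"
  "AM v m = Pr (Pr apex (AM (slice_map t ftr_id) m)) (AM q' (lab m))"
  by (simp_all add: v_def)

lemma is_functor_k: "is_functor J Y k"
  unfolding k_def
proof (rule is_functor_cone_ftr)
  show "category E" by (rule category_slice[OF X X is_functor_id])
  show "is_functor E Y (q \<circ>\<^sub>F slice_proj)"
    by (rule is_functor_comp[OF is_functor_slice_proj functors(3)])
  show "OM s y \<in> Ob Y" by (rule s(1)[OF y])
  fix c assume "c \<in> Ob E"
  then show "Comp Y p (AM q (psnd c)) \<in> Mor Y \<and>
      Dom Y (Comp Y p (AM q (psnd c))) = OM (q \<circ>\<^sub>F slice_proj) c \<and>
      Cod Y (Comp Y p (AM q (psnd c))) = OM s y"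
    by (elim Ob_sliceE) (simp add: cat_facts[OF Y] q p)
next
  fix m assume "m \<in> Mor E"
  then obtain a f l a' f' where m: "m = Lab (Pr a f) l (Pr a' f')" "f' \<in> Mor X" "Dom X f' = a'"
      "Cod X f' = x" "l \<in> Mor X" "Cod X l = a'" "Comp X f' l = f"
    by (elim Mor_sliceE) auto
  \<comment> \<open>Naturality of the cocone: apply \<open>q\<close> to \<open>f' l = f\<close> and
    compose with \<open>p\<close>.\<close>
  have "Comp Y (Comp Y p (AM q f')) (AM q l) = Comp Y p (AM q (Comp X f' l))"
    using m(2-6) by (simp add: q p cat_facts[OF Y])
  then show "Comp Y (Comp Y p (AM q (psnd (Cod E m)))) (AM (q \<circ>\<^sub>F slice_proj) m) =
      Comp Y p (AM q (psnd (Dom E m)))"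
    using m by simp
qed (rule Y)

lemma is_functor_v: "is_functor Q P v"
  and is_functor_e: "is_functor Q E (slice_map t ftr_id)"
proof -
  show e: "is_functor Q E (slice_map t ftr_id)"
    using is_functor_slice_map[OF X' functors(1) functors(1) is_functor_id is_functor_id, of x]
    by (simp add: ftr_eq_def)
  show "is_functor Q P v"
  proof
    show "OM v z \<in> Ob P" if "z \<in> Ob Q" for z
      using ftr_facts(1)[OF e that] that
      by (auto simp: fibre_product_def k_def q' commutes_Ob elim!: Ob_sliceE)
    show "AM v m \<in> Mor P" if "m \<in> Mor Q" for m
      using ftr_facts(2)[OF e that] that
      by (auto simp: fibre_product_def k_def q' commutes_Mor elim!: Mor_sliceE)
  next
    fix m n assume "m \<in> Mor Q" "n \<in> Mor Q" "Cod Q m = Dom Q n"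
    then show "AM v (Comp Q n m) = Comp P (AM v n) (AM v m)"
      using ftr_facts(6)[OF e]
      by (auto simp: fibre_product_def q' t elim!: Mor_sliceE)
  qed (auto simp: fibre_product_def q' t elim!: Mor_sliceE Ob_sliceE)
qed

text \<open>On \<open>E\<close> the functor \<open>k\<close> is \<open>q\<close> after the
  projection, so an object of \<open>P\<close> over \<open>Pr a f\<close> amounts to
  \<open>d\<close> in \<open>Y'\<close> with \<open>q(a) = s(d)\<close>. The given square turns
  \<open>(a, d)\<close> into a unique object of \<open>X'\<close>, to which \<open>f\<close> is
  attached; arrows behave likewise.\<close>

lemma cartesian_Q: "cartesian_square small Q P E J v (slice_map t ftr_id) ftr_fst cone_incl"
  unfolding cartesian_square_iff
proof (intro conjI)
  show E: "small_category small E" by (intro small_category_slice small_cats is_functor_id)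
  then show "small_category small J" by (rule small_category_right_cone)
  then show "small_category small P"
    by (rule small_category_fibre_product[OF _ small_cats(3) is_functor_k functors(4)])
  show "small_category small Q" by (intro small_category_slice small_cats functors)
  show "ftr_eq Q (ftr_fst \<circ>\<^sub>F v) (cone_incl \<circ>\<^sub>F slice_map t ftr_id)"
    by (simp add: ftr_eq_def ftr_fst_def)
  show "elementwise_cartesian Q P E v (slice_map t ftr_id) ftr_fst cone_incl"
    unfolding elementwise_cartesian_def
  proof (intro conjI ballI impI)
    fix w c assume w: "w \<in> Ob P" and c: "c \<in> Ob E" and wc: "OM ftr_fst w = OM cone_incl c"
    obtain a f where af: "c = Pr a f" "a \<in> Ob X" "f \<in> Mor X" "Dom X f = a" "Cod X f = x"
      using c by (elim Ob_sliceE) simp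
    obtain d where d: "w = Pr (Pr apex c) d" "d \<in> Ob Y'" "OM q a = OM s d"
      using w wc by (auto simp: fibre_product_def ftr_fst_def k_def af(1))
    have "\<exists>!z. z \<in> Ob X' \<and> OM t z = a \<and> OM q' z = d"
      using cart af(2) d(2,3) by (simp add: cartesian_square_iff elementwise_cartesian_def)
    then obtain z where z: "z \<in> Ob X'" "OM t z = a" "OM q' z = d"
      and uniq: "\<And>z'. \<lbrakk>z' \<in> Ob X'; OM t z' = a; OM q' z' = d\<rbrakk> \<Longrightarrow> z' = z" by blast
    show "\<exists>!z. z \<in> Ob Q \<and> OM v z = w \<and> OM (slice_map t ftr_id) z = c"
    proof (rule ex1I[of _ "Pr z f"])
      show "Pr z f \<in> Ob Q \<and> OM v (Pr z f) = w \<and> OM (slice_map t ftr_id) (Pr z f) = c"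
        using af z by (simp add: d(1))
      fix z' assume z': "z' \<in> Ob Q \<and> OM v z' = w \<and> OM (slice_map t ftr_id) z' = c"
      then have "z' \<in> Ob Q" by simp
      then show "z' = Pr z f"
        by (rule Ob_sliceE) (use z' af(1) d(1) uniq in simp)
    qed
  next
    fix w c assume w: "w \<in> Mor P" and c: "c \<in> Mor E" and wc: "AM ftr_fst w = AM cone_incl c"
    obtain a f l a' f' where af: "c = Lab (Pr a f) l (Pr a' f')" "f \<in> Mor X" "Dom X f = a"
      "Cod X f = x" "f' \<in> Mor X" "Dom X f' = a'" "Cod X f' = x" "l \<in> Mor X" "Dom X l = a"
      "Cod X l = a'" "Comp X f' l = f"
      using c by (elim Mor_sliceE) simp
    obtain d where d: "w = Pr (Pr apex c) d" "d \<in> Mor Y'" "AM q l = AM s d"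
      using w wc af(1) by (auto simp: fibre_product_def ftr_fst_def k_def)
    have "\<exists>!m. m \<in> Mor X' \<and> AM t m = l \<and> AM q' m = d"
      using cart af(8) d(2,3) by (simp add: cartesian_square_iff elementwise_cartesian_def)
    then obtain m where m: "m \<in> Mor X'" "AM t m = l" "AM q' m = d"
      and uniq: "\<And>m'. \<lbrakk>m' \<in> Mor X'; AM t m' = l; AM q' m' = d\<rbrakk> \<Longrightarrow> m' = m" by blast
    \<comment> \<open>The label \<open>m\<close> fixes the components of both end points in
      \<open>X'\<close>; the structure arrows are those of \<open>c\<close>.\<close>
    let ?m = "Lab (Pr (Dom X' m) f) m (Pr (Cod X' m) f')"
    have a: "OM t (Dom X' m) = a" "OM t (Cod X' m) = a'"
      using t(3,4)[OF m(1)] m(2) af(9,10) by simp_all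
    show "\<exists>!z. z \<in> Mor Q \<and> AM v z = w \<and> AM (slice_map t ftr_id) z = c"
    proof (rule ex1I[of _ ?m])
      show "?m \<in> Mor Q \<and> AM v ?m = w \<and> AM (slice_map t ftr_id) ?m = c"
        using af m a by (simp add: d(1) cat_facts(1,2)[OF X'])
      fix n assume n: "n \<in> Mor Q \<and> AM v n = w \<and> AM (slice_map t ftr_id) n = c"
      then have "n \<in> Mor Q" by simp
      then show "n = ?m"
        by (rule Mor_sliceE) (use n af(1) d(1) uniq in simp)
    qed
  qed
qed (rule is_functor_v is_functor_e is_functor_fst is_functor_cone_incl)+

text \<open>The diagram over \<open>s\<close> has top row \<open>Q\<close>, \<open>P\<close>,
  \<open>Y'\<close> and bottom row \<open>E\<close>, \<open>J\<close>, \<open>Y\<close>. Since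
  \<open>E\<close> has a final object its inclusion in \<open>J\<close> is aspheric, hence so is
  \<open>v\<close>; the apex and \<open>y\<close> form an object of \<open>P\<close> because
  \<open>k\<close> sends the apex to \<open>s(y)\<close>.\<close>

lemma slice_v_mem:
  assumes A: "right_asphericity_structure small \<A>" and smooth: "smooth small \<A> Y' Y s"
  shows "slice Q P v (Pr apex y) \<in> \<A>"
proof -
  have E: "small_category small E" by (intro small_category_slice small_cats is_functor_id)
  \<comment> \<open>Flipped, since \<open>smooth\<close> expects \<open>s\<close> as the right
    vertical arrow.\<close>
  have "cartesian_square small P Y' J Y ftr_snd ftr_fst s k"
    by (rule cartesian_square_flip)
      (intro cartesian_square_fibre_product small_category_right_cone E small_cats is_functor_k functors)
  moreover have "aspheric \<A> E J cone_incl"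
    by (rule aspheric_cone_incl[OF A universe_axioms E final_object_slice_id[OF X x]])
  ultimately have "aspheric \<A> Q P v"
    using smooth cartesian_Q unfolding smooth_def by blast
  moreover have "Pr apex y \<in> Ob P" using y by (simp add: fibre_product_def k_def)
  ultimately show ?thesis by (simp add: aspheric_def)
qed

section \<open>Comparison of the slices of \<open>slice_map t s\<close> and of
  \<open>v\<close>\<close>

abbreviation S :: "'a cat" where
  "S \<equiv> slice X' Y' q' y"

abbreviation T :: "'a cat" where
  "T \<equiv> slice X Y q (OM s y)"

text \<open>Objects of both \<open>slice S T (slice_map t s) (Pr x p)\<close> and \<open>slice Q P v (Pr apex y)\<close> amount to an
  object \<open>a\<close> of \<open>X'\<close> with arrows \<open>r : q'(a) \<rightarrow> y\<close> and \<open>f : t(a) \<rightarrow> x\<close> such that \<open>p \<circ> q(f) = s(r)\<close>.\<close>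

definition datum :: "'a elt \<Rightarrow> 'a elt \<Rightarrow> 'a elt \<Rightarrow> bool" where
  "datum a r f \<longleftrightarrow> a \<in> Ob X' \<and> r \<in> Mor Y' \<and> Dom Y' r = OM q' a \<and> Cod Y' r = y \<and>
    f \<in> Mor X \<and> Dom X f = OM t a \<and> Cod X f = x \<and> Comp Y p (AM q f) = AM s r"

text \<open>The object \<open>Pr a r\<close> of \<open>S\<close> with the arrow labelled
  \<open>f\<close> in \<open>T\<close> from its image to \<open>Pr x p\<close>.\<close>

definition obS :: "'a elt \<Rightarrow> 'a elt \<Rightarrow> 'a elt \<Rightarrow> 'a elt" where
  "obS a r f = Pr (Pr a r) (Lab (Pr (OM t a) (AM s r)) f (Pr x p))"

text \<open>The roles of \<open>r\<close> and \<open>f\<close> are exchanged: \<open>Pr a f\<close>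
  is the object of \<open>Q\<close>, and its arrow in \<open>P\<close> to the pair of the apex and
  \<open>y\<close> consists of the cone arrow and \<open>r\<close>.\<close>

definition obQ :: "'a elt \<Rightarrow> 'a elt \<Rightarrow> 'a elt \<Rightarrow> 'a elt" where
  "obQ a r f = Pr (Pr a f) (Pr (Lab (Pr apex (Pr (OM t a) f)) apex apex) r)"

definition compare :: "'a ftr" where
  "compare = (let om = (\<lambda>z. obQ (pfst (pfst z)) (psnd (pfst z)) (lab (psnd z))) in
    \<lparr>OM = om, AM = (\<lambda>m. Lab (om (lsrc m))
      (Lab (pfst (om (lsrc m))) (lab (lab m)) (pfst (om (ltgt m)))) (om (ltgt m)))\<rparr>)"

lemma Ob_S_iff:
  "z \<in> Ob (slice S T (slice_map t s) (Pr x p)) \<longleftrightarrow> (\<exists>a r f. z = obS a r f \<and> datum a r f)"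
  unfolding obS_def datum_def
  using x p by (auto elim!: Ob_sliceE Mor_sliceE simp: t s commutes_Ob)

text \<open>An arrow \<open>(n, r)\<close> of \<open>P\<close> satisfies \<open>k(n) = s(r)\<close>;
  as \<open>k\<close> sends the cone arrow at \<open>Pr (t(a)) f\<close> to \<open>p q(f)\<close>,
  this is the equation in \<open>datum\<close>.\<close>

lemma Ob_Q_iff:
  "z \<in> Ob (slice Q P v (Pr apex y)) \<longleftrightarrow> (\<exists>a r f. z = obQ a r f \<and> datum a r f)"
proof
  assume "z \<in> Ob (slice Q P v (Pr apex y))"
  then obtain w m where z: "z = Pr w m" "w \<in> Ob Q" "m \<in> Mor P" "Dom P m = OM v w"
      "Cod P m = Pr apex y"
    by (rule Ob_sliceE)
  obtain a f where w: "w = Pr a f" "a \<in> Ob X'" "f \<in> Mor X" "Dom X f = OM t a" "Cod X f = x"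
    using z(2) by (rule Ob_sliceE)
  obtain n r where m: "m = Pr n r" "n \<in> Mor J" "r \<in> Mor Y'" "AM k n = AM s r"
    using z(3) by (auto simp: fibre_product_def)
  \<comment> \<open>The target is the apex and the source comes from \<open>E\<close>, which leaves
    only the new arrow.\<close>
  have n: "n = Lab (Pr apex (Pr (OM t a) f)) apex apex"
    using m(2) by (rule Mor_right_coneE) (use z(4,5) m(1) w(1) in \<open>simp_all add: fibre_product_sel\<close>)
  have "Dom Y' r = OM q' a" "Cod Y' r = y"
    using z(4,5) by (simp_all add: m(1) w(1) fibre_product_sel)
  moreover have "Comp Y p (AM q f) = AM s r" using m(4) by (simp add: n k_def)
  ultimately show "\<exists>a r f. z = obQ a r f \<and> datum a r f"
    using w m(3) unfolding datum_def obQ_def z(1) w(1) m(1) n by blast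
next
  assume "\<exists>a r f. z = obQ a r f \<and> datum a r f"
  then obtain a r f where z: "z = obQ a r f" and d: "datum a r f" by blast
  have "Pr a f \<in> Ob Q" using d by (simp add: datum_def)
  then show "z \<in> Ob (slice Q P v (Pr apex y))"
    using d unfolding z obQ_def Pr_Ob_slice[of _ _ Q]
    by (simp add: fibre_product_sel datum_def k_def t)
qed

text \<open>Being an arrow of \<open>S\<close> gives the condition relating \<open>r\<close> and
  \<open>r'\<close>; the triangle over \<open>Pr x p\<close> gives the one relating \<open>f\<close>
  and \<open>f'\<close>.\<close>

lemma Mor_S_iff:
  assumes "datum a r f" "datum a' r' f'"
  shows "m \<in> Mor (slice S T (slice_map t s) (Pr x p)) \<and> lsrc m = obS a r f \<and> ltgt m = obS a' r' f' \<longleftrightarrow>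
    (\<exists>l. m = Lab (obS a r f) (Lab (Pr a r) l (Pr a' r')) (obS a' r' f') \<and>
      l \<in> Mor X' \<and> Dom X' l = a \<and> Cod X' l = a' \<and>
      Comp Y' r' (AM q' l) = r \<and> Comp X f' (AM t l) = f)"
  (is "?L \<longleftrightarrow> ?R")
proof
  assume L: ?L
  then have "m \<in> Mor (slice S T (slice_map t s) (Pr x p))" by simp
  then obtain z g n z' g' where m: "m = Lab (Pr z g) n (Pr z' g')" "n \<in> Mor S" "Dom S n = z"
      "Cod S n = z'" "Comp T g' (AM (slice_map t s) n) = g"
    by (rule Mor_sliceE)
  have z: "z = Pr a r" "z' = Pr a' r'"
    using L m(1) by (simp_all add: obS_def)
  from m(2) obtain l where l: "n = Lab (Pr a r) l (Pr a' r')" "l \<in> Mor X'" "Dom X' l = a"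
      "Cod X' l = a'" "Comp Y' r' (AM q' l) = r"
    by (rule Mor_sliceE) (use m(3,4) z in simp)
  have "Comp X f' (AM t l) = f" using m(5) L unfolding m(1) l(1) by (simp add: obS_def)
  moreover have "m = Lab (obS a r f) (Lab (Pr a r) l (Pr a' r')) (obS a' r' f')"
    using L m(1) l(1) by simp
  ultimately show ?R using l by blast
next
  assume ?R
  then obtain l where l: "m = Lab (obS a r f) (Lab (Pr a r) l (Pr a' r')) (obS a' r' f')"
      "l \<in> Mor X'" "Dom X' l = a" "Cod X' l = a'" "Comp Y' r' (AM q' l) = r"
      "Comp X f' (AM t l) = f"
    by blast
  have ob: "obS a r f \<in> Ob (slice S T (slice_map t s) (Pr x p))"
    "obS a' r' f' \<in> Ob (slice S T (slice_map t s) (Pr x p))"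
    using assms Ob_S_iff by blast+
  have "Lab (Pr a r) l (Pr a' r') \<in> Mor S" using l assms by (simp add: datum_def)
  then have "m \<in> Mor (slice S T (slice_map t s) (Pr x p))"
    using ob l(6) unfolding l(1) obS_def Lab_Mor_slice[of _ _ _ _ _ S] by simp
  then show ?L by (simp add: l(1))
qed

text \<open>The conditions of \<open>Mor_S_iff\<close> with origins exchanged: \<open>Q\<close>
  accounts for \<open>f\<close>, the triangle in \<open>P\<close> for \<open>r\<close>. The
  component of that triangle in \<open>J\<close> is automatic, a composite ending with the cone
  arrow being again a cone arrow.\<close>

lemma Mor_Q_iff:
  assumes "datum a r f" "datum a' r' f'"
  shows "m \<in> Mor (slice Q P v (Pr apex y)) \<and> lsrc m = obQ a r f \<and> ltgt m = obQ a' r' f' \<longleftrightarrow>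
    (\<exists>l. m = Lab (obQ a r f) (Lab (Pr a f) l (Pr a' f')) (obQ a' r' f') \<and>
      l \<in> Mor X' \<and> Dom X' l = a \<and> Cod X' l = a' \<and>
      Comp Y' r' (AM q' l) = r \<and> Comp X f' (AM t l) = f)"
  (is "?L \<longleftrightarrow> ?R")
proof
  assume L: ?L
  then have "m \<in> Mor (slice Q P v (Pr apex y))" by simp
  then obtain z g n z' g' where m: "m = Lab (Pr z g) n (Pr z' g')" "n \<in> Mor Q" "Dom Q n = z"
      "Cod Q n = z'" "Comp P g' (AM v n) = g"
    by (rule Mor_sliceE)
  have z: "z = Pr a f" "z' = Pr a' f'"
    using L m(1) by (simp_all add: obQ_def)
  from m(2) obtain l where l: "n = Lab (Pr a f) l (Pr a' f')" "l \<in> Mor X'" "Dom X' l = a"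
      "Cod X' l = a'" "Comp X f' (AM t l) = f"
    by (rule Mor_sliceE) (use m(3,4) z in simp)
  have "Comp Y' r' (AM q' l) = r"
    using m(5) L unfolding m(1) l(1) by (simp add: obQ_def fibre_product_sel)
  moreover have "m = Lab (obQ a r f) (Lab (Pr a f) l (Pr a' f')) (obQ a' r' f')"
    using L m(1) l(1) by simp
  ultimately show ?R using l by blast
next
  assume ?R
  then obtain l where l: "m = Lab (obQ a r f) (Lab (Pr a f) l (Pr a' f')) (obQ a' r' f')"
      "l \<in> Mor X'" "Dom X' l = a" "Cod X' l = a'" "Comp Y' r' (AM q' l) = r"
      "Comp X f' (AM t l) = f"
    by blast
  have ob: "obQ a r f \<in> Ob (slice Q P v (Pr apex y))" "obQ a' r' f' \<in> Ob (slice Q P v (Pr apex y))"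
    using assms Ob_Q_iff by blast+
  have "Lab (Pr a f) l (Pr a' f') \<in> Mor Q" using l assms by (simp add: datum_def)
  then have "m \<in> Mor (slice Q P v (Pr apex y))"
    using ob l(5) unfolding l(1) obQ_def Lab_Mor_slice[of _ _ _ _ _ Q]
    by (simp add: fibre_product_sel)
  then show ?L by (simp add: l(1))
qed

lemma compare_obS: "OM compare (obS a r f) = obQ a r f"
  by (simp add: compare_def obS_def)

lemma compare_Mor:
  "AM compare (Lab (obS a r f) (Lab w l w') (obS a' r' f')) =
    Lab (obQ a r f) (Lab (Pr a f) l (Pr a' f')) (obQ a' r' f')"
  by (simp add: compare_def obS_def obQ_def)

text \<open>Both slices are described by the same data \<open>(a, r, f)\<close> and the same arrows
  \<open>l\<close>, so \<open>compare\<close> only repackages them.\<close>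

lemma surjective_equivalence_compare:
  "surjective_equivalence (slice S T (slice_map t s) (Pr x p)) (slice Q P v (Pr apex y)) compare"
  (is "surjective_equivalence ?C ?D compare")
proof -
  have catC: "category ?C"
    by (intro category_slice X' Y' X Y functors is_functor_slice_map commutes)
  have Mor: "\<exists>a r f a' r' f'. datum a r f \<and> datum a' r' f' \<and> lsrc m = obS a r f \<and> ltgt m = obS a' r' f'"
    if "m \<in> Mor ?C" for m
    using cat_facts(1,2)[OF catC that] unfolding Ob_S_iff by (simp, blast)
  have "is_functor ?C ?D compare"
  proof
    show "OM compare z \<in> Ob ?D" if z: "z \<in> Ob ?C" for z
    proof -
      obtain a r f where "z = obS a r f" "datum a r f" using z unfolding Ob_S_iff by blast
      then show ?thesis using Ob_Q_iff compare_obS by simp blast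
    qed
    show "AM compare m \<in> Mor ?D" if m: "m \<in> Mor ?C" for m
    proof -
      obtain a r f a' r' f' where d: "datum a r f" "datum a' r' f'" "lsrc m = obS a r f"
          "ltgt m = obS a' r' f'"
        using Mor[OF m] by blast
      obtain l where l: "m = Lab (obS a r f) (Lab (Pr a r) l (Pr a' r')) (obS a' r' f')"
          "l \<in> Mor X'" "Dom X' l = a" "Cod X' l = a'"
          "Comp Y' r' (AM q' l) = r" "Comp X f' (AM t l) = f"
        using m d(3,4) iffD1[OF Mor_S_iff[OF d(1,2), of m]] by blast
      show ?thesis
        unfolding l(1) compare_Mor using iffD2[OF Mor_Q_iff[OF d(1,2)]] l(2-) by blast
    qed
  qed (simp_all add: compare_def obQ_def)
  moreover have "\<exists>z\<in>Ob ?C. OM compare z = w" if w: "w \<in> Ob ?D" for w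
  proof -
    obtain a r f where "w = obQ a r f" "datum a r f" using w unfolding Ob_Q_iff by blast
    then show ?thesis using Ob_S_iff compare_obS by (intro bexI[of _ "obS a r f"]) blast+
  qed
  moreover have "\<exists>!m. m \<in> Mor ?C \<and> Dom ?C m = z \<and> Cod ?C m = z' \<and> AM compare m = g"
    if zg: "z \<in> Ob ?C" "z' \<in> Ob ?C" "g \<in> Mor ?D" "Dom ?D g = OM compare z"
      "Cod ?D g = OM compare z'" for z z' g
  proof -
    obtain a r f a' r' f' where z: "z = obS a r f" "z' = obS a' r' f'"
      and d: "datum a r f" "datum a' r' f'"
      using zg(1,2) unfolding Ob_S_iff by blast
    obtain l where l: "g = Lab (obQ a r f) (Lab (Pr a f) l (Pr a' f')) (obQ a' r' f')"
        "l \<in> Mor X'" "Dom X' l = a" "Cod X' l = a'"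
        "Comp Y' r' (AM q' l) = r" "Comp X f' (AM t l) = f"
      using iffD1[OF Mor_Q_iff[OF d, of g]] zg(3-5) unfolding z compare_obS slice_sel by blast
    let ?m = "\<lambda>l. Lab (obS a r f) (Lab (Pr a r) l (Pr a' r')) (obS a' r' f')"
    have m: "?m l \<in> Mor ?C \<and> lsrc (?m l) = obS a r f \<and> ltgt (?m l) = obS a' r' f'"
      using Mor_S_iff[OF d] l by blast
    have uniq: "m = ?m l"
      if mm: "m \<in> Mor ?C" "lsrc m = obS a r f" "ltgt m = obS a' r' f'" "AM compare m = g" for m
    proof -
      obtain l' where "m = ?m l'" using Mor_S_iff[OF d, of m] mm(1-3) by blast
      with mm(4) l(1) show ?thesis by (simp add: compare_Mor)
    qed
    show ?thesis
    proof (rule ex1I[of _ "?m l"])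
      show "?m l \<in> Mor ?C \<and> Dom ?C (?m l) = z \<and> Cod ?C (?m l) = z' \<and> AM compare (?m l) = g"
        using m unfolding z compare_Mor l(1) slice_sel by blast
      fix m assume "m \<in> Mor ?C \<and> Dom ?C m = z \<and> Cod ?C m = z' \<and> AM compare m = g"
      then show "m = ?m l" unfolding z slice_sel by (intro uniq) blast+
    qed
  qed
  ultimately show ?thesis unfolding surjective_equivalence_def by blast
qed

lemma slice_slice_map_mem:
  assumes A: "right_asphericity_structure small \<A>" and smooth: "smooth small \<A> Y' Y s"
  shows "slice S T (slice_map t s) (Pr x p) \<in> \<A>"
proof (rule mem_of_surjective_equivalence[OF A _ _ surjective_equivalence_compare slice_v_mem[OF A smooth]
    universe_axioms])
  show "small_category small (slice S T (slice_map t s) (Pr x p))"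
    by (intro small_category_slice small_cats functors is_functor_slice_map X' commutes)
  show "small_category small (slice Q P v (Pr apex y))"
    using cartesian_Q by (intro small_category_slice[OF _ _ is_functor_v]) (simp_all add: cartesian_square_iff)
qed

end

text \<open>Each object of the target slice is some \<open>Pr x p\<close> and instantiates
  \<open>cartesian_fibre\<close>. Condition (b) follows by taking a Grothendieck construction for
  \<open>X\<close>.\<close>

lemma aspheric_slice_map:
  assumes "universe small" "right_asphericity_structure small \<A>" "smooth small \<A> Y' Y s"
    and "cartesian_square small X' X Y' Y t q' q s" and "y \<in> Ob Y'"
  shows "aspheric \<A> (slice X' Y' q' y) (slice X Y q (OM s y)) (slice_map t s)"
  unfolding aspheric_def
proof
  fix z assume "z \<in> Ob (slice X Y q (OM s y))"
  then obtain x p where z: "z = Pr x p" "x \<in> Ob X" "p \<in> Mor Y" "Dom Y p = OM q x"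
      "Cod Y p = OM s y"
    by (rule Ob_sliceE)
  interpret cartesian_fibre small X' X Y' Y t q' q s x p y
    by (intro cartesian_fibre.intro cartesian_fibre_axioms.intro assms z)
  show "slice (slice X' Y' q' y) (slice X Y q (OM s y)) (slice_map t s) z \<in> \<A>"
    unfolding z(1) by (rule slice_slice_map_mem[OF assms(2,3)])
qed

text \<open>A diagram over \<open>u'\<close> becomes one over \<open>u\<close> by pasting the given
  square onto its right.\<close>

lemma (in universe) smooth_base_change:
  assumes u: "smooth small \<A> A B u" and sq: "cartesian_square small A' B' A B u' a b u"
  shows "smooth small \<A> A' B' u'"
  unfolding smooth_def
proof (intro allI impI, elim conjE)
  fix P Q P' Q' a' b' v w p p'
  assume 1: "cartesian_square small P A' Q B' a' p u' b'"
    and 2: "cartesian_square small P' P Q' Q v p' p w" and w: "aspheric \<A> Q' Q w"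
  \<comment> \<open>\<open>cartesian_square_paste\<close> composes the vertical arrows, whereas here
    the horizontal ones are composed; hence the flips.\<close>
  have "cartesian_square small P A Q B (a \<circ>\<^sub>F a') p u (b \<circ>\<^sub>F b')"
    by (rule cartesian_square_flip[OF cartesian_square_paste[OF cartesian_square_flip[OF 1] sq]])
  with 2 w u show "aspheric \<A> P' P v" unfolding smooth_def by blast
qed

subsection \<open>Grothendieck constructions\<close>

lemma groth_sel [simp]:
  "Dom (groth I F) = lsrc"
  "Cod (groth I F) = ltgt"
  "Id (groth I F) z = Lab z (Pr (Id I (pfst z)) (Id (CO F (pfst z)) (psnd z))) z"
  "Comp (groth I F) n m = Lab (lsrc m)
    (Pr (Comp I (pfst (lab n)) (pfst (lab m)))
      (Comp (CO F (pfst (ltgt n))) (psnd (lab n)) (AM (CM F (pfst (lab n))) (psnd (lab m)))))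
    (ltgt n)"
  by (simp_all add: groth_def)

lemma Pr_Ob_groth [simp]: "Pr i x \<in> Ob (groth I F) \<longleftrightarrow> i \<in> Ob I \<and> x \<in> Ob (CO F i)"
  by (simp add: groth_def)

lemma Lab_Mor_groth [simp]:
  "Lab (Pr i x) (Pr k f) (Pr j y) \<in> Mor (groth I F) \<longleftrightarrow>
    Pr i x \<in> Ob (groth I F) \<and> Pr j y \<in> Ob (groth I F) \<and>
    k \<in> Mor I \<and> Dom I k = i \<and> Cod I k = j \<and>
    f \<in> Mor (CO F j) \<and> Dom (CO F j) f = OM (CM F k) x \<and> Cod (CO F j) f = y"
  by (auto simp: groth_def)

lemma Ob_grothE:
  assumes "z \<in> Ob (groth I F)"
  obtains i x where "z = Pr i x" "i \<in> Ob I" "x \<in> Ob (CO F i)"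
  using assms by (auto simp: groth_def)

lemma Mor_grothE:
  assumes "m \<in> Mor (groth I F)"
  obtains i x k f j y where "m = Lab (Pr i x) (Pr k f) (Pr j y)"
    "i \<in> Ob I" "x \<in> Ob (CO F i)" "j \<in> Ob I" "y \<in> Ob (CO F j)"
    "k \<in> Mor I" "Dom I k = i" "Cod I k = j"
    "f \<in> Mor (CO F j)" "Dom (CO F j) f = OM (CM F k) x" "Cod (CO F j) f = y"
  using assms by (auto simp: groth_def)

lemma groth_proj_sel [simp]: "OM groth_proj z = pfst z" "AM groth_proj m = pfst (lab m)"
  by (simp_all add: groth_proj_def)

lemma groth_map_sel [simp]:
  "OM (groth_map t) z = Pr (OM t (pfst z)) (psnd z)"
  "AM (groth_map t) m = Lab (OM (groth_map t) (lsrc m))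
    (Pr (AM t (pfst (lab m))) (psnd (lab m))) (OM (groth_map t) (ltgt m))"
  by (simp_all add: groth_map_def)

lemma pull_sel [simp]: "CO (pull t F) i = CO F (OM t i)" "CM (pull t F) k = CM F (AM t k)"
  by (simp_all add: pull_def)

lemma cat_valued_functorD:
  assumes "cat_valued_functor small I F"
  shows "i \<in> Ob I \<Longrightarrow> small_category small (CO F i)"
    and "k \<in> Mor I \<Longrightarrow> is_functor (CO F (Dom I k)) (CO F (Cod I k)) (CM F k)"
    and "i \<in> Ob I \<Longrightarrow> ftr_eq (CO F i) (CM F (Id I i)) ftr_id"
    and "\<lbrakk>k \<in> Mor I; l \<in> Mor I; Cod I k = Dom I l\<rbrakk> \<Longrightarrow>
      ftr_eq (CO F (Dom I k)) (CM F (Comp I l k)) (CM F l \<circ>\<^sub>F CM F k)"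
  using assms by (auto simp: cat_valued_functor_def)

lemma category_groth:
  assumes I: "category I" and F: "cat_valued_functor small I F"
  shows "category (groth I F)"
proof -
  let ?G = "groth I F"
  note i = cat_facts[OF I]
  have c: "category (CO F i)" if "i \<in> Ob I" for i
    by (rule small_categoryD(1)[OF cat_valued_functorD(1)[OF F that]])
  have id_Ob: "OM (CM F (Id I i)) x = x" if "i \<in> Ob I" "x \<in> Ob (CO F i)" for i x
    using cat_valued_functorD(3)[OF F that(1)] that by (simp add: ftr_eq_def)
  have id_Mor: "AM (CM F (Id I i)) f = f" if "i \<in> Ob I" "f \<in> Mor (CO F i)" for i f
    using cat_valued_functorD(3)[OF F that(1)] that by (simp add: ftr_eq_def)
  show ?thesis
  proof
    show "Id ?G z \<in> Mor ?G" if "z \<in> Ob ?G" for z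
      using that by (rule Ob_grothE) (simp add: i cat_facts[OF c] id_Ob)
  next
    fix m n assume mn: "m \<in> Mor ?G" "n \<in> Mor ?G" "Cod ?G m = Dom ?G n"
    obtain i x k f j y where m: "m = Lab (Pr i x) (Pr k f) (Pr j y)"
        "i \<in> Ob I" "x \<in> Ob (CO F i)" "j \<in> Ob I" "y \<in> Ob (CO F j)"
        "k \<in> Mor I" "Dom I k = i" "Cod I k = j"
        "f \<in> Mor (CO F j)" "Dom (CO F j) f = OM (CM F k) x" "Cod (CO F j) f = y"
      using mn(1) by (rule Mor_grothE)
    obtain l g j' y' where n: "n = Lab (Pr j y) (Pr l g) (Pr j' y')"
        "j' \<in> Ob I" "y' \<in> Ob (CO F j')" "l \<in> Mor I" "Dom I l = j" "Cod I l = j'"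
        "g \<in> Mor (CO F j')" "Dom (CO F j') g = OM (CM F l) y" "Cod (CO F j') g = y'"
      using mn(2) by (rule Mor_grothE) (use mn(3) m(1) in simp)
    have l: "is_functor (CO F j) (CO F j') (CM F l)"
      using cat_valued_functorD(2)[OF F n(4)] n by simp
    \<comment> \<open>Functoriality of \<open>F\<close> on objects: the fibre component of the
      composite starts where it should.\<close>
    have "OM (CM F (Comp I l k)) x = OM (CM F l) (OM (CM F k) x)"
      using cat_valued_functorD(4)[OF F m(6) n(4)] m n by (simp add: ftr_eq_def)
    then show "Comp ?G n m \<in> Mor ?G"
      using m n by (simp add: i cat_facts[OF c[OF n(2)]] ftr_facts[OF l])
  next
    fix m n o' assume mno: "m \<in> Mor ?G" "n \<in> Mor ?G" "o' \<in> Mor ?G" "Cod ?G m = Dom ?G n"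
      "Cod ?G n = Dom ?G o'"
    obtain i x k f j y where m: "m = Lab (Pr i x) (Pr k f) (Pr j y)"
        "k \<in> Mor I" "Cod I k = j" "f \<in> Mor (CO F j)" "Cod (CO F j) f = y"
      using mno(1) by (rule Mor_grothE)
    obtain l g j' y' where n: "n = Lab (Pr j y) (Pr l g) (Pr j' y')"
        "l \<in> Mor I" "Dom I l = j" "Cod I l = j'"
        "g \<in> Mor (CO F j')" "Dom (CO F j') g = OM (CM F l) y" "Cod (CO F j') g = y'"
      using mno(2) by (rule Mor_grothE) (use mno(4) m(1) in simp)
    obtain l' g' j'' y'' where o': "o' = Lab (Pr j' y') (Pr l' g') (Pr j'' y'')"
        "j'' \<in> Ob I" "l' \<in> Mor I" "Dom I l' = j'" "Cod I l' = j''"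
        "g' \<in> Mor (CO F j'')" "Dom (CO F j'') g' = OM (CM F l') y'"
      using mno(3) by (rule Mor_grothE) (use mno(5) n(1) in simp)
    have l: "is_functor (CO F j) (CO F j') (CM F l)" "is_functor (CO F j') (CO F j'') (CM F l')"
      using cat_valued_functorD(2)[OF F n(2)] cat_valued_functorD(2)[OF F o'(3)] n o' by simp_all
    \<comment> \<open>For associativity, the same law on arrows matches the two transports of
      \<open>f\<close>.\<close>
    have "AM (CM F (Comp I l' l)) f = AM (CM F l') (AM (CM F l) f)"
      using cat_valued_functorD(4)[OF F n(2) o'(3)] m n o' by (simp add: ftr_eq_def)
    then show "Comp ?G o' (Comp ?G n m) = Comp ?G (Comp ?G o' n) m"
      using m n o' by (simp add: i cat_facts[OF c[OF o'(2)]] ftr_facts[OF l(1)] ftr_facts[OF l(2)])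
  next
    fix m assume "m \<in> Mor ?G"
    then obtain i x k f j y where m: "m = Lab (Pr i x) (Pr k f) (Pr j y)"
        "i \<in> Ob I" "x \<in> Ob (CO F i)" "j \<in> Ob I" "y \<in> Ob (CO F j)"
        "k \<in> Mor I" "Dom I k = i" "Cod I k = j"
        "f \<in> Mor (CO F j)" "Dom (CO F j) f = OM (CM F k) x" "Cod (CO F j) f = y"
      by (rule Mor_grothE)
    have k: "is_functor (CO F i) (CO F j) (CM F k)"
      using cat_valued_functorD(2)[OF F m(6)] m by simp
    \<comment> \<open>Composing with the identity of \<open>Pr i x\<close> transports
      \<open>Id x\<close> along \<open>F(k)\<close>, giving the identity of
      \<open>F(k)(x)\<close>.\<close>
    have "Comp (CO F j) f (Id (CO F j) (OM (CM F k) x)) = f"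
      using cat_facts(9)[OF c[OF m(4)] m(9)] m(10) by simp
    then show "Comp ?G m (Id ?G (Dom ?G m)) = m"
      using m(1) i(9)[OF m(6)] m(7) by (simp add: ftr_facts[OF k] m(3))
    have "Comp (CO F j) (Id (CO F j) y) f = f"
      using cat_facts(10)[OF c[OF m(4)] m(9)] m(11) by simp
    then show "Comp ?G (Id ?G (Cod ?G m)) m = m"
      using m(1) i(10)[OF m(6)] m(8) id_Mor[OF m(4,9)] by simp
  qed (auto elim!: Ob_grothE Mor_grothE)
qed

lemma (in universe) small_category_groth:
  assumes I: "small_category small I" and F: "cat_valued_functor small I F"
  shows "small_category small (groth I F)"
  unfolding small_category_def
proof (intro conjI)
  note i = small_categoryD[OF I]
  have c: "small (Ob (CO F i))" "small (Mor (CO F i))" if "i \<in> Ob I" for i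
    using small_categoryD(2,3)[OF cat_valued_functorD(1)[OF F that]] .
  show "category (groth I F)" by (rule category_groth[OF i(1) F])
  \<comment> \<open>\<open>small_Pr\<close> pairs two fixed sets, so the fibres are first collected
    into one small set.\<close>
  have "small (\<Union>i\<in>Ob I. Ob (CO F i))" "small (\<Union>i\<in>Ob I. Mor (CO F i))"
    by (intro small_UN i(2) c; assumption)+
  note u = this
  show ob: "small (Ob (groth I F))"
    by (rule small_subset[OF small_Pr[OF i(2) u(1)]]) (auto elim!: Ob_grothE)
  show "small (Mor (groth I F))"
    by (rule small_subset[OF small_Lab[OF ob small_Pr[OF i(3) u(2)] ob]])
      (fastforce elim!: Mor_grothE)
qed

lemma is_functor_groth_proj: "is_functor (groth I F) I groth_proj"
  by unfold_locales (auto elim!: Ob_grothE Mor_grothE)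

lemma cat_valued_functor_pull:
  assumes F: "cat_valued_functor small I F" and t: "is_functor I' I t"
  shows "cat_valued_functor small I' (pull t F)"
  unfolding cat_valued_functor_def
proof (intro conjI ballI impI)
  show "is_functor (CO (pull t F) (Dom I' k)) (CO (pull t F) (Cod I' k)) (CM (pull t F) k)"
    if "k \<in> Mor I'" for k
    using cat_valued_functorD(2)[OF F ftr_facts(2)[OF t that]] that by (simp add: ftr_facts[OF t])
  show "ftr_eq (CO (pull t F) (Dom I' k)) (CM (pull t F) (Comp I' l k))
      (CM (pull t F) l \<circ>\<^sub>F CM (pull t F) k)"
    if "k \<in> Mor I'" "l \<in> Mor I'" "Cod I' k = Dom I' l" for k l
    using cat_valued_functorD(4)[OF F, of "AM t k" "AM t l"] that by (simp add: ftr_facts[OF t])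
qed (simp_all add: ftr_facts[OF t] cat_valued_functorD[OF F])

lemma is_functor_groth_map:
  assumes t: "is_functor I' I t"
  shows "is_functor (groth I' (pull t F)) (groth I F) (groth_map t)"
  by unfold_locales (auto elim!: Ob_grothE Mor_grothE simp: ftr_facts[OF t])

text \<open>The value of \<open>pull t F\<close> at \<open>i'\<close> is that of \<open>F\<close> at
  \<open>t(i')\<close>, so \<open>(t(i'), x)\<close> and \<open>i'\<close> have
  \<open>(i', x)\<close> as their only common lift; arrows lift with the same fibre
  component.\<close>

lemma (in universe) cartesian_square_groth:
  assumes I': "small_category small I'" and I: "small_category small I"
    and F: "cat_valued_functor small I F" and t: "is_functor I' I t"
  shows "cartesian_square small (groth I' (pull t F)) (groth I F) I' I
    (groth_map t) groth_proj groth_proj t"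
proof -
  let ?G' = "groth I' (pull t F)" and ?G = "groth I F"
  have "elementwise_cartesian ?G' ?G I' (groth_map t) groth_proj groth_proj t"
    unfolding elementwise_cartesian_def
  proof (intro conjI ballI impI)
    fix z i' assume z: "z \<in> Ob ?G" "i' \<in> Ob I'" "OM groth_proj z = OM t i'"
    obtain x where x: "z = Pr (OM t i') x" "x \<in> Ob (CO F (OM t i'))"
      using z(1) by (rule Ob_grothE) (use z(3) in simp)
    show "\<exists>!z'. z' \<in> Ob ?G' \<and> OM (groth_map t) z' = z \<and> OM groth_proj z' = i'"
    proof (rule ex1I[of _ "Pr i' x"])
      show "Pr i' x \<in> Ob ?G' \<and> OM (groth_map t) (Pr i' x) = z \<and> OM groth_proj (Pr i' x) = i'"
        using z(2) x by simp
      fix w assume w: "w \<in> Ob ?G' \<and> OM (groth_map t) w = z \<and> OM groth_proj w = i'"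
      then have "w \<in> Ob ?G'" by simp
      then show "w = Pr i' x" by (rule Ob_grothE) (use w x(1) in simp)
    qed
  next
    fix m k' assume m: "m \<in> Mor ?G" "k' \<in> Mor I'" "AM groth_proj m = AM t k'"
    obtain i x k f j y where mk: "m = Lab (Pr i x) (Pr k f) (Pr j y)"
        and f: "x \<in> Ob (CO F i)" "y \<in> Ob (CO F j)" "f \<in> Mor (CO F j)"
          "Dom (CO F j) f = OM (CM F k) x" "Cod (CO F j) f = y"
        and ij: "Dom I k = i" "Cod I k = j"
      using m(1) by (rule Mor_grothE)
    have k: "k = AM t k'" using m(3) mk by simp
    have "i = OM t (Dom I' k')" "j = OM t (Cod I' k')"
      using ij ftr_facts(3,4)[OF t m(2)] by (simp_all add: k)
    note x = mk[unfolded this k] f[unfolded this k]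
    let ?m = "Lab (Pr (Dom I' k') x) (Pr k' f) (Pr (Cod I' k') y)"
    show "\<exists>!m'. m' \<in> Mor ?G' \<and> AM (groth_map t) m' = m \<and> AM groth_proj m' = k'"
    proof (rule ex1I[of _ ?m])
      show "?m \<in> Mor ?G' \<and> AM (groth_map t) ?m = m \<and> AM groth_proj ?m = k'"
        using m(2) x by (simp add: cat_facts[OF small_categoryD(1)[OF I']])
      fix n assume n: "n \<in> Mor ?G' \<and> AM (groth_map t) n = m \<and> AM groth_proj n = k'"
      have "n \<in> Mor ?G'" using n by simp
      then show "n = ?m"
      proof (rule Mor_grothE)
        fix i1 x1 k1 f1 j1 y1
        assume n1: "n = Lab (Pr i1 x1) (Pr k1 f1) (Pr j1 y1)" and d: "Dom I' k1 = i1" "Cod I' k1 = j1"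
        have "k1 = k'" "x1 = x" "f1 = f" "y1 = y" using n x(1) unfolding n1 by simp_all
        then show "n = ?m" using d unfolding n1 by blast
      qed
    qed
  qed
  moreover have "ftr_eq ?G' (groth_proj \<circ>\<^sub>F groth_map t) (t \<circ>\<^sub>F groth_proj)"
    by (simp add: ftr_eq_def)
  ultimately show ?thesis
    unfolding cartesian_square_iff
    by (intro conjI I I' t small_category_groth[OF I' cat_valued_functor_pull[OF F t]]
        small_category_groth[OF I F] is_functor_groth_map[OF t] is_functor_groth_proj)
qed

section \<open>The constant functor with value a point\<close>

definition point :: "'a cat" where
  "point = \<lparr>Ob = {apex}, Mor = {apex}, Dom = (\<lambda>_. apex), Cod = (\<lambda>_. apex), Id = (\<lambda>_. apex),
    Comp = (\<lambda>_ _. apex)\<rparr>"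

definition const_point :: "'a cftr" where
  "const_point = \<lparr>CO = (\<lambda>_. point), CM = (\<lambda>_. ftr_id)\<rparr>"

lemma const_point_sel [simp]: "CO const_point i = point" "CM const_point k = ftr_id"
  by (simp_all add: const_point_def)

text \<open>Constancy makes this an equality of records, so both Grothendieck constructions in (b)
  are those of \<open>const_point\<close>.\<close>

lemma pull_const_point [simp]: "pull t const_point = const_point"
  by (simp add: pull_def const_point_def comp_def)

lemma (in universe) cat_valued_functor_const_point: "cat_valued_functor small I const_point"
proof -
  have "category point" by unfold_locales (simp_all add: point_def)
  moreover have "small {apex}" using small_doubleton[of apex apex] by simp
  ultimately have "small_category small point" by (simp add: small_category_def point_def)
  then show ?thesis
    by (simp add: cat_valued_functor_def is_functor_id ftr_eq_def)
qed

lemma surjective_equivalence_groth_proj: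
  "surjective_equivalence (groth I const_point) I groth_proj"
  unfolding surjective_equivalence_def
proof (intro conjI ballI impI)
  fix i assume "i \<in> Ob I"
  then show "\<exists>z\<in>Ob (groth I const_point). OM groth_proj z = i"
    by (intro bexI[of _ "Pr i apex"]) (simp_all add: point_def)
next
  fix z z' k assume z: "z \<in> Ob (groth I const_point)" "z' \<in> Ob (groth I const_point)"
    and k: "k \<in> Mor I" "Dom I k = OM groth_proj z \<and> Cod I k = OM groth_proj z'"
  have zz: "z = Pr (Dom I k) apex" "z' = Pr (Cod I k) apex"
    using z k(2) by (auto simp: point_def elim!: Ob_grothE)
  let ?G = "groth I const_point"
  show "\<exists>!m. m \<in> Mor ?G \<and> Dom ?G m = z \<and> Cod ?G m = z' \<and> AM groth_proj m = k"
  proof (rule ex1I[of _ "Lab z (Pr k apex) z'"])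
    show "Lab z (Pr k apex) z' \<in> Mor ?G \<and> Dom ?G (Lab z (Pr k apex) z') = z \<and>
        Cod ?G (Lab z (Pr k apex) z') = z' \<and> AM groth_proj (Lab z (Pr k apex) z') = k"
      using z k(1) unfolding zz by (simp add: point_def)
    fix m assume m: "m \<in> Mor ?G \<and> Dom ?G m = z \<and> Cod ?G m = z' \<and> AM groth_proj m = k"
    then have "m \<in> Mor ?G" by simp
    then show "m = Lab z (Pr k apex) z'"
      by (rule Mor_grothE) (use m in \<open>simp add: point_def\<close>)
  qed
qed (rule is_functor_groth_proj)

text \<open>Inverse to \<open>groth_proj\<close>; it carries membership from slices of the
  Grothendieck construction to slices of \<open>I\<close>.\<close>

definition groth_point_section :: "'a cat \<Rightarrow> 'a ftr" where
  "groth_point_section I = \<lparr>OM = (\<lambda>i. Pr i apex),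
    AM = (\<lambda>k. Lab (Pr (Dom I k) apex) (Pr k apex) (Pr (Cod I k) apex))\<rparr>"

lemma groth_point_section_sel [simp]:
  "OM (groth_point_section I) i = Pr i apex"
  "AM (groth_point_section I) k = Lab (Pr (Dom I k) apex) (Pr k apex) (Pr (Cod I k) apex)"
  by (simp_all add: groth_point_section_def)

lemma surjective_equivalence_groth_point_section:
  assumes I: "category I"
  shows "surjective_equivalence I (groth I const_point) (groth_point_section I)"
  unfolding surjective_equivalence_def
proof (intro conjI ballI impI)
  show "is_functor I (groth I const_point) (groth_point_section I)"
    by unfold_locales (simp_all add: point_def cat_facts[OF I])
  fix z assume "z \<in> Ob (groth I const_point)"
  then show "\<exists>i\<in>Ob I. OM (groth_point_section I) i = z"
    by (rule Ob_grothE) (simp add: point_def)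
next
  fix i j m assume "m \<in> Mor (groth I const_point)"
    "Dom (groth I const_point) m = OM (groth_point_section I) i \<and>
      Cod (groth I const_point) m = OM (groth_point_section I) j"
  then show "\<exists>!k. k \<in> Mor I \<and> Dom I k = i \<and> Cod I k = j \<and> AM (groth_point_section I) k = m"
    by (elim Mor_grothE) (auto simp: point_def)
qed

subsection \<open>The characterization of smooth functors\<close>

text \<open>Pasting puts \<open>groth_map t\<close> on top of a single square over \<open>s\<close>,
  whose \<open>slice_map\<close> is the base change functor.\<close>

lemma (in universe) cartesian_square_groth_paste:
  assumes sq: "cartesian_square small X' X Y' Y t q' q s" and F: "cat_valued_functor small X F"
  shows "cartesian_square small (groth X' (pull t F)) (groth X F) Y' Y
    (groth_map t) (q' \<circ>\<^sub>F groth_proj) (q \<circ>\<^sub>F groth_proj) s"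
  using sq cartesian_square_paste[OF cartesian_square_groth[OF _ _ F] sq]
  by (simp add: cartesian_square_iff)

text \<open>For the constant functor the slices in (b) are equivalent to those of \<open>q'\<close>
  and \<open>q\<close>. Asphericity of \<open>q\<close> puts the target of the base change functor
  in \<open>\<A>\<close>, the closure axiom then its source, and hence the slice of
  \<open>q'\<close>.\<close>

lemma slice_mem_of_base_change:
  assumes "universe small" and A: "right_asphericity_structure small \<A>"
    and sq: "cartesian_square small X' X Y' Y t q' q s" and q: "aspheric \<A> X Y q"
    and y: "y \<in> Ob Y'"
    and bc: "aspheric \<A> (slice (groth X' const_point) Y' (q' \<circ>\<^sub>F groth_proj) y)
      (slice (groth X const_point) Y (q \<circ>\<^sub>F groth_proj) (OM s y)) (base_change t s)"
  shows "slice X' Y' q' y \<in> \<A>"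
proof -
  interpret universe small by fact
  let ?G' = "groth X' const_point" and ?G = "groth X const_point"
  let ?S' = "slice ?G' Y' (q' \<circ>\<^sub>F groth_proj) y" and ?S = "slice ?G Y (q \<circ>\<^sub>F groth_proj) (OM s y)"
  have cats: "small_category small X'" "small_category small X" "small_category small Y'"
      "small_category small Y"
    and functors: "is_functor X' Y' q'" "is_functor X Y q" "is_functor Y' Y s"
    using sq by (simp_all add: cartesian_square_iff)
  note c = cats[THEN small_categoryD(1)]
  note G = cartesian_square_groth_paste[OF sq cat_valued_functor_const_point, simplified]
  have Gcats: "small_category small ?G'" "small_category small ?G"
    and Gfunctors: "is_functor ?G' ?G (groth_map t)" "is_functor ?G' Y' (q' \<circ>\<^sub>F groth_proj)"
      "is_functor ?G Y (q \<circ>\<^sub>F groth_proj)"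
    and comm: "ftr_eq ?G' ((q \<circ>\<^sub>F groth_proj) \<circ>\<^sub>F groth_map t) (s \<circ>\<^sub>F (q' \<circ>\<^sub>F groth_proj))"
    using G by (simp_all add: cartesian_square_iff)
  note Gc = Gcats[THEN small_categoryD(1)]
  have S': "small_category small ?S'" and S: "small_category small ?S"
    by (intro small_category_slice cats Gcats Gfunctors)+
  \<comment> \<open>Membership is to pass from the slice of \<open>q\<close> to \<open>?S\<close>,
    so the projection is used.\<close>
  have "surjective_equivalence ?S (slice X Y q (OM s y)) (slice_map groth_proj ftr_id)"
    by (rule surjective_equivalence_slice[OF Gc(2) c(2,4) surjective_equivalence_groth_proj
        Gfunctors(3) functors(2)]) (simp add: ftr_eq_def)
  moreover have "slice X Y q (OM s y) \<in> \<A>"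
    using q ftr_facts(1)[OF functors(3) y] by (simp add: aspheric_def)
  ultimately have "?S \<in> \<A>"
    using mem_of_surjective_equivalence[OF A S small_category_slice[OF cats(2,4) functors(2)]]
      universe_axioms by blast
  moreover have "is_functor ?S' ?S (base_change t s)"
    unfolding base_change_eq
    by (intro is_functor_slice_map Gc Gfunctors functors comm)
  ultimately have "?S' \<in> \<A>"
    using A S' S bc unfolding right_asphericity_structure_def aspheric_def by blast
  \<comment> \<open>Membership is now to leave \<open>?S'\<close>, so the section is used
    instead.\<close>
  moreover have "surjective_equivalence (slice X' Y' q' y) ?S'
      (slice_map (groth_point_section X') ftr_id)"
    by (rule surjective_equivalence_slice[OF c(1) Gc(1) c(3)
        surjective_equivalence_groth_point_section[OF c(1)] functors(1) Gfunctors(2)])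
      (simp add: ftr_eq_def)
  ultimately show ?thesis
    using mem_of_surjective_equivalence[OF A small_category_slice[OF cats(1,3) functors(1)] S']
      universe_axioms by blast
qed

theorem theorem4p4:
  fixes small :: "'a elt set \<Rightarrow> bool" and \<A> :: "'a cat set"
    and A B :: "'a cat" and u :: "'a ftr"
  assumes "universe small"
    and "right_asphericity_structure small \<A>"
    and "small_category small A" and "small_category small B" and "is_functor A B u"
  shows "smooth small \<A> A B u \<longleftrightarrow>
    (\<forall>A' B' A'' B'' a b v w u' u''.
      cartesian_square small A'' B'' A' B' u'' v w u' \<and>
      cartesian_square small A' B' A B u' a b u \<longrightarrow>
      (\<forall>F. cat_valued_functor small B'' F \<longrightarrow>
        (\<forall>a'\<in>Ob A'.
          aspheric \<A>
            (CO (shriek A'' A' v (pull u'' F)) a')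
            (CO (pull u' (shriek B'' B' w F)) a')
            (base_change u'' u'))))"
  (is "_ \<longleftrightarrow> ?b")
proof -
  interpret universe small by fact
  show ?thesis
  proof
    assume smooth: "smooth small \<A> A B u"
    show ?b
    proof (intro allI impI ballI, elim conjE)
      fix A' B' A'' B'' a b v w u' u'' F a'
      assume sq: "cartesian_square small A'' B'' A' B' u'' v w u'"
        "cartesian_square small A' B' A B u' a b u"
        and F: "cat_valued_functor small B'' F" and a': "a' \<in> Ob A'"
      show "aspheric \<A> (CO (shriek A'' A' v (pull u'' F)) a')
          (CO (pull u' (shriek B'' B' w F)) a') (base_change u'' u')"
        \<comment> \<open>\<open>u'\<close> is smooth by base change, and the pasted square lies
          over it.\<close>
        using aspheric_slice_map[OF assms(1,2) smooth_base_change[OF smooth sq(2)]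
            cartesian_square_groth_paste[OF sq(1) F] a']
        by (simp add: shriek_def base_change_eq)
    qed
  next
    assume b: ?b
    show "smooth small \<A> A B u"
      unfolding smooth_def
    proof (intro allI impI, elim conjE)
      fix A' B' A'' B'' a b v w u' u''
      assume sq: "cartesian_square small A' A B' B a u' u b"
        "cartesian_square small A'' A' B'' B' v u'' u' w" and w: "aspheric \<A> B'' B' w"
      \<comment> \<open>In (b) the squares are stacked with \<open>u'\<close> as a horizontal arrow,
        in \<open>smooth\<close> they stand side by side with \<open>u'\<close> vertical.\<close>
      note sq' = cartesian_square_flip[OF sq(2)] cartesian_square_flip[OF sq(1)]
      show "aspheric \<A> A'' A' v"
        unfolding aspheric_def
      proof
        fix a' assume a': "a' \<in> Ob A'"
        have "aspheric \<A> (CO (shriek A'' A' v (pull u'' const_point)) a')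
            (CO (pull u' (shriek B'' B' w const_point)) a') (base_change u'' u')"
          using b sq' a' cat_valued_functor_const_point by blast
        then have "aspheric \<A> (slice (groth A'' const_point) A' (v \<circ>\<^sub>F groth_proj) a')
            (slice (groth B'' const_point) B' (w \<circ>\<^sub>F groth_proj) (OM u' a')) (base_change u'' u')"
          by (simp add: shriek_def)
        then show "slice A'' A' v a' \<in> \<A>"
          by (rule slice_mem_of_base_change[OF assms(1,2) sq'(1) w a'])
      qed
    qed
  qed
qed

end
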